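(* Let $Q\in\mathcal{S}_o^n$ and $p>0$. If $K,L\in\mathcal{K}_o^n$, then $$\frac{1}{nV(Q)}\int_{S^{n-1}}\log\left(\frac{\rho_L(u)}{\rho_K(u)}\right)\rho_Q^n(u)\,du\le\frac1p\log\frac{\widetilde{V}_{p,0}(K,L,Q)}{V(Q)},$$ with equality if and only if $K$ and $L$ are dilates.
   Context: $S^{n-1}$ is the unit sphere of $\mathbb{R}^n$, $du$ is spherical Lebesgue measure, and $V$ is volume in $\mathbb{R}^n$. $\mathcal{K}_o^n$ is the set of convex bodies (compact convex sets with non-empty interior) in $\mathbb{R}^n$ containing the origin in their interiors. $\mathcal{S}_o^n$ is the set of star bodies (compact sets, star-shaped with respect to the origin, with continuous radial function) in $\mathbb{R}^n$ containing the origin in their interiors. The radial function is $\rho_Q(u)=\max\{\lambda\ge 0:\lambda u\in Q\}$, $u\in S^{n-1}$, and the support function is $h_K(v)=\max\{v\cdot x:x\in K\}$. $K$ and $L$ are dilates if $K=\lambda L$ for some $\lambda>0$. For $K\in\mathcal{K}_o^n$ and a Borel set $\eta\subseteq S^{n-1}$, $\boldsymbol{\alpha}^*_K(\eta)$ is the set of $u\in S^{n-1}$ such that some $v\in\eta$ is an outer unit normal of $K$ at $\rho_K(u)u$, i.e. $\rho_K(u)u\cdot v=h_K(v)$. For $p,q\in\mathbb{R}$ put $\widetilde{C}_q(K,Q,\eta)=\frac1n\int_{\boldsymbol{\alpha}^*_K(\eta)}\rho_K^q(u)\rho_Q^{n-q}(u)\,du$ and $d\widetilde{C}_{p,q}(K,Q,\cdot)=h_K^{-p}\,d\widetilde{C}_q(K,Q,\cdot)$.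 The $L_p$ dual mixed volume is $\widetilde{V}_{p,q}(K,L,Q)=\int_{S^{n-1}}h_L^p(v)\,d\widetilde{C}_{p,q}(K,Q,v)$; here it is used with $q=0$. *)

theory Defs
  imports "HOL-Analysis.Analysis"
begin

text \<open>
  Euclidean space of dimension n is an arbitrary type of class
  \<^class>\<open>euclidean_space\<close> with n its \<open>DIM\<close>, and the unit sphere is \<open>sphere 0 1\<close>.
\<close>

text \<open>
  In polar coordinates, the spherical measure of a Borel set E is n times the volume of the
  cone of all x with 0 < |x| < 1 and x/|x| in E; here \<open>sgn x\<close> is x/|x|.
  The completion is taken because, for Borel E, the sets \<open>rev_radial_gauss_image K E\<close> below
  need only be Lebesgue measurable.
\<close>

definition spherical_lebesgue :: "'a::euclidean_space measure" where
  "spherical_lebesgue =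
     completion (scale_measure (of_nat DIM('a))
       (distr (restrict_space lborel (ball 0 1 - {0})) (restrict_space borel (sphere 0 1)) sgn))"

text \<open>
  On compact sets containing the origin (and nonzero u) the suprema in the next two
  definitions are maxima.
\<close>

definition radial_fun :: "'a::real_vector set \<Rightarrow> 'a \<Rightarrow> real" where
  "radial_fun Q u = Sup {t. 0 \<le> t \<and> t *\<^sub>R u \<in> Q}"

definition support_fun :: "'a::real_inner set \<Rightarrow> 'a \<Rightarrow> real" where
  "support_fun K v = (SUP x\<in>K. v \<bullet> x)"

definition convex_bodies_o :: "'a::euclidean_space set set" where
  "convex_bodies_o = {K. compact K \<and> convex K \<and> 0 \<in> interior K}"

definition star_bodies_o :: "'a::euclidean_space set set" where
  "star_bodies_o = {Q. compact Q \<and> (\<forall>x\<in>Q. closed_segment 0 x \<subseteq> Q) \<and>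
     continuous_on (sphere 0 1) (radial_fun Q) \<and> 0 \<in> interior Q}"

definition dilates :: "'a::real_vector set \<Rightarrow> 'a set \<Rightarrow> bool" where
  "dilates K L \<longleftrightarrow> (\<exists>c>0. K = (*\<^sub>R) c ` L)"

definition rev_radial_gauss_image :: "'a::euclidean_space set \<Rightarrow> 'a set \<Rightarrow> 'a set" where
  "rev_radial_gauss_image K E =
     {u \<in> sphere 0 1. \<exists>v\<in>E. (radial_fun K u *\<^sub>R u) \<bullet> v = support_fun K v}"

text \<open>
  For K in \<open>convex_bodies_o\<close> and Q in \<open>star_bodies_o\<close> the set function below is countably
  additive on the Borel sets of the sphere, because almost every boundary point of K has a
  unique outer unit normal; so \<^const>\<open>measure_of\<close> yields the measure with these values.
\<close>

definition dual_curvature_measure ::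
    "real \<Rightarrow> 'a::euclidean_space set \<Rightarrow> 'a set \<Rightarrow> 'a measure" where
  "dual_curvature_measure q K Q =
     measure_of (sphere 0 1) (sets (restrict_space borel (sphere 0 1)))
       (\<lambda>E. ennreal (1 / real DIM('a)) *
          (\<integral>\<^sup>+u\<in>rev_radial_gauss_image K E.
             ennreal (radial_fun K u powr q * radial_fun Q u powr (real DIM('a) - q))
           \<partial>spherical_lebesgue))"

definition Lp_dual_curvature_measure ::
    "real \<Rightarrow> real \<Rightarrow> 'a::euclidean_space set \<Rightarrow> 'a set \<Rightarrow> 'a measure" where
  "Lp_dual_curvature_measure p q K Q =
     density (dual_curvature_measure q K Q) (\<lambda>v. ennreal (support_fun K v powr (- p)))"

definition Lp_dual_mixed_volume ::
    "real \<Rightarrow> real \<Rightarrow> 'a::euclidean_space set \<Rightarrow> 'a set \<Rightarrow> 'a set \<Rightarrow> real" where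
  "Lp_dual_mixed_volume p q K L Q =
     (LINT v|Lp_dual_curvature_measure p q K Q. support_fun L v powr p)"

end

theory Submission
  imports Defs
begin

text \<open>
  Write \<open>n\<close> for the dimension and let the unit sphere carry the probability measure with density
  \<open>\<rho>\<^sub>Q ^ n / (n * V(Q))\<close>. It has total mass one by the polar coordinate formula for the volume of \<open>Q\<close>
  (\<open>volume_star_body\<close>).

  For almost every direction \<open>u\<close> the boundary point of \<open>K\<close> in direction \<open>u\<close> has exactly one outer
  unit normal \<open>\<alpha>(u)\<close>. The dual curvature measure is therefore an image measure under \<open>\<alpha>\<close>
  (\<open>dual_curvature_measure_eq_distr\<close>), and for \<open>q = 0\<close> the mixed volume divided by \<open>V(Q)\<close> becomes
  the mean of the \<open>p\<close>-th power of \<open>h\<^sub>L(\<alpha>(u)) / h\<^sub>K(\<alpha>(u))\<close>. Since \<open>\<rho>\<^sub>L(u) u\<close> is a point of \<open>L\<close>, it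
  satisfies \<open>\<rho>\<^sub>L(u) u \<bullet> \<alpha>(u) \<le> h\<^sub>L(\<alpha>(u))\<close>, while for \<open>K\<close> equality holds by the choice of \<open>\<alpha>(u)\<close>. Hence
  \<open>\<rho>\<^sub>L / \<rho>\<^sub>K \<le> (h\<^sub>L / h\<^sub>K) \<circ> \<alpha>\<close> (\<open>radial_quotient_le_support_quotient\<close>). Jensen's inequality for
  \<open>f = ln (\<rho>\<^sub>L / \<rho>\<^sub>K)\<close> bounds the mean of \<open>f\<close> by \<open>1 / p\<close> times the logarithm of the mean of \<open>exp (p f)\<close>,
  that is of \<open>(\<rho>\<^sub>L / \<rho>\<^sub>K) ^ p\<close>, and the pointwise inequality finishes the estimate.

  If equality holds, it holds in Jensen's inequality, so \<open>f\<close> is constant almost everywhere, and by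
  continuity everywhere: the radial functions are proportional and the bodies are dilates.
  Conversely, for dilates both quotients are the same constant.

  The uniqueness of normals rests on convexity in one variable. The Minkowski functional \<open>g\<close> of \<open>K\<close>
  is a convex Lipschitz function, and outer normals are, up to scaling, subgradients of \<open>g\<close>. Two
  distinct subgradients at \<open>x\<close> differ in a coordinate direction \<open>b\<close>, and a rational number \<open>q\<close>
  between their \<open>b\<close>-coordinates is a slope for which \<open>g\<close> has a strict kink at \<open>x\<close>. For fixed \<open>b\<close>
  and \<open>q\<close> each line in direction \<open>b\<close> contains at most one such point, so that the set of all of
  them is null (\<open>kink_null\<close>).
\<close>

section \<open>Radial functions\<close>

lemma convex_bodyD:
  assumes "K \<in> convex_bodies_o"
  shows "compact K" "convex K" "0 \<in> interior K" "0 \<in> K"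
  using assms interior_subset by (auto simp: convex_bodies_o_def)

lemma convex_body_star_shaped:
  "K \<in> convex_bodies_o \<Longrightarrow> x \<in> K \<Longrightarrow> closed_segment 0 x \<subseteq> K"
  using convex_bodyD closed_segment_subset by metis

lemma star_bodyD:
  assumes "Q \<in> star_bodies_o"
  shows "compact Q" "0 \<in> interior Q" "0 \<in> Q" "continuous_on (sphere 0 1) (radial_fun Q)"
    "\<And>x. x \<in> Q \<Longrightarrow> closed_segment 0 x \<subseteq> Q"
  using assms interior_subset unfolding star_bodies_o_def by blast+

text \<open>
  Compactness makes the set of admissible multiples bounded and closed, so that the supremum in
  \<^const>\<open>radial_fun\<close> is an attained maximum.
\<close>

lemma radial_fun_ge:
  assumes "compact K" "norm u = 1" "0 \<le> t" "t *\<^sub>R u \<in> K"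
  shows "t \<le> radial_fun K u"
proof -
  obtain R where R: "\<And>x. x \<in> K \<Longrightarrow> norm x \<le> R"
    using compact_imp_bounded[OF assms(1)] bounded_iff by blast
  have "bdd_above {t. 0 \<le> t \<and> t *\<^sub>R u \<in> K}"
    using R assms(2) by (force intro!: bdd_aboveI[of _ R])
  then show ?thesis
    unfolding radial_fun_def using assms by (intro cSup_upper) auto
qed

lemma radial_fun_mem:
  assumes "compact K" "0 \<in> K" "norm u = 1"
  shows "radial_fun K u *\<^sub>R u \<in> K" "0 \<le> radial_fun K u"
proof -
  let ?T = "{t. 0 \<le> t \<and> t *\<^sub>R u \<in> K}"
  obtain R where R: "\<And>x. x \<in> K \<Longrightarrow> norm x \<le> R"
    using compact_imp_bounded[OF assms(1)] bounded_iff by blast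
  have "bdd_above ?T"
    using R assms(3) by (force intro!: bdd_aboveI[of _ R])
  moreover have "closed ?T"
  proof -
    have "closed ((\<lambda>t. t *\<^sub>R u) -` K)"
      by (intro closed_vimage compact_imp_closed assms continuous_intros)
    then have "closed ({0..} \<inter> (\<lambda>t. t *\<^sub>R u) -` K)"
      by (intro closed_Int) auto
    moreover have "?T = {0..} \<inter> (\<lambda>t. t *\<^sub>R u) -` K" by auto
    ultimately show ?thesis by simp
  qed
  moreover have "0 \<in> ?T" using assms by simp
  ultimately have "Sup ?T \<in> ?T"
    by (intro closed_contains_Sup) auto
  then show "radial_fun K u *\<^sub>R u \<in> K" "0 \<le> radial_fun K u"
    by (auto simp: radial_fun_def)
qed

lemma radial_fun_pos:
  assumes "compact K" "0 \<in> interior K" "norm u = 1"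
  shows "0 < radial_fun K u"
proof -
  obtain r where r: "0 < r" "ball 0 r \<subseteq> K"
    using assms(2) by (auto simp: mem_interior)
  have "r/2 \<le> radial_fun K u"
    using r assms by (intro radial_fun_ge) (auto simp: subset_iff)
  then show ?thesis using r(1) by linarith
qed

text \<open>
  A body that is star-shaped about the origin is recovered from its radial function; this is
  what turns proportional radial functions into dilated bodies.
\<close>

lemma mem_if_norm_le_radial_fun:
  assumes "compact K" "0 \<in> K" and star: "\<And>x. x \<in> K \<Longrightarrow> closed_segment 0 x \<subseteq> K"
    and "x \<noteq> 0" "norm x \<le> radial_fun K (sgn x)"
  shows "x \<in> K"
proof -
  let ?t = "radial_fun K (sgn x)"
  have u: "norm (sgn x) = 1" using assms by (simp add: norm_sgn)
  have pos: "0 < norm x" "0 < ?t" using assms(4,5) zero_less_norm_iff[of x] by linarith+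
  have "x = (norm x / ?t) *\<^sub>R (?t *\<^sub>R sgn x)"
    using pos by (simp add: sgn_div_norm)
  moreover have "norm x / ?t \<le> 1" "0 \<le> norm x / ?t" using pos assms by auto
  ultimately have "x \<in> closed_segment 0 (?t *\<^sub>R sgn x)"
    unfolding in_segment by (intro exI[of _ "norm x / ?t"]) auto
  then show ?thesis using star[OF radial_fun_mem(1)[OF assms(1,2) u]] by blast
qed

lemma norm_le_radial_fun:
  assumes "compact K" "x \<in> K" "x \<noteq> 0"
  shows "norm x \<le> radial_fun K (sgn x)"
  using assms by (intro radial_fun_ge) (auto simp: norm_sgn sgn_div_norm)

lemma dilates_if_radial_fun_proportional:
  fixes K L :: "'a::euclidean_space set"
  assumes K: "K \<in> convex_bodies_o" and L: "L \<in> convex_bodies_o" and "0 < c"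
    and eq: "\<And>u. norm u = 1 \<Longrightarrow> radial_fun L u = c * radial_fun K u"
  shows "dilates K L"
proof -
  have mem: "x \<in> M \<longleftrightarrow> x = 0 \<or> norm x \<le> radial_fun M (sgn x)"
    if "M \<in> convex_bodies_o" for M and x :: 'a
    using mem_if_norm_le_radial_fun[of M x] norm_le_radial_fun[of M x] convex_bodyD[OF that]
      convex_body_star_shaped[OF that] by blast
  have scale: "x \<in> K \<longleftrightarrow> c *\<^sub>R x \<in> L" for x
    using mem[OF K, of x] mem[OF L, of "c *\<^sub>R x"] eq[of "sgn x"] \<open>0 < c\<close>
    by (auto simp: sgn_scaleR norm_sgn)
  have "K = (*\<^sub>R) (1 / c) ` L"
  proof (intro set_eqI iffI)
    fix x assume "x \<in> K"
    then have "c *\<^sub>R x \<in> L" using scale by blast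
    then show "x \<in> (*\<^sub>R) (1 / c) ` L"
      by (rule image_eqI[rotated]) (use \<open>0 < c\<close> in simp)
  next
    fix x assume "x \<in> (*\<^sub>R) (1 / c) ` L"
    then obtain y where y: "y \<in> L" "x = (1 / c) *\<^sub>R y" by blast
    have "c *\<^sub>R x = y" unfolding y(2) using \<open>0 < c\<close> by simp
    then show "x \<in> K" using scale y(1) by metis
  qed
  moreover have "0 < 1 / c" using \<open>0 < c\<close> by simp
  ultimately show ?thesis unfolding dilates_def by (intro exI conjI)
qed

lemma radial_fun_dilate:
  assumes "compact L" "0 \<in> L" "0 < c" "norm u = 1"
  shows "radial_fun ((*\<^sub>R) c ` L) u = c * radial_fun L u"
proof (rule antisym)
  have *: "compact ((*\<^sub>R) c ` L)" "0 \<in> (*\<^sub>R) c ` L"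
    using compact_scaling[OF assms(1), of c] image_eqI[of 0 "(*\<^sub>R) c" 0 L] assms(2)
    by simp_all
  have "(c * radial_fun L u) *\<^sub>R u \<in> (*\<^sub>R) c ` L"
    unfolding scaleR_scaleR[symmetric] by (intro imageI radial_fun_mem assms)
  then show "c * radial_fun L u \<le> radial_fun ((*\<^sub>R) c ` L) u"
    using radial_fun_mem(2)[OF assms(1,2,4)] \<open>0 < c\<close>
    by (intro radial_fun_ge[OF *(1) assms(4)]) (simp_all only: mult_nonneg_nonneg less_imp_le)
  obtain y where y: "y \<in> L" "radial_fun ((*\<^sub>R) c ` L) u *\<^sub>R u = c *\<^sub>R y"
    using radial_fun_mem(1)[OF * assms(4)] by (rule imageE)
  have "(radial_fun ((*\<^sub>R) c ` L) u / c) *\<^sub>R u = (1 / c) *\<^sub>R (radial_fun ((*\<^sub>R) c ` L) u *\<^sub>R u)"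
    by simp
  also have "\<dots> = y" unfolding y(2) using assms(3) by simp
  finally have "(radial_fun ((*\<^sub>R) c ` L) u / c) *\<^sub>R u \<in> L"
    using y(1) by (simp only:)
  then have "radial_fun ((*\<^sub>R) c ` L) u / c \<le> radial_fun L u"
    using radial_fun_mem(2)[OF * assms(4)] \<open>0 < c\<close>
    by (intro radial_fun_ge[OF assms(1,4)]) (simp_all only: divide_nonneg_pos)
  then show "radial_fun ((*\<^sub>R) c ` L) u \<le> c * radial_fun L u"
    using assms(3) by (simp only: pos_divide_le_eq mult.commute)
qed

section \<open>Support functions\<close>

lemma inner_le_support_fun:
  assumes "compact K" "x \<in> K"
  shows "v \<bullet> x \<le> support_fun K v"
proof -
  obtain R where R: "\<And>x. x \<in> K \<Longrightarrow> norm x \<le> R"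
    using compact_imp_bounded[OF assms(1)] bounded_iff by blast
  have "v \<bullet> y \<le> norm v * R" if "y \<in> K" for y
    using norm_cauchy_schwarz[of v y] mult_left_mono[OF R[OF that], of "norm v"] by simp
  then have "bdd_above ((\<bullet>) v ` K)"
    by (auto intro!: bdd_aboveI[of _ "norm v * R"])
  then show ?thesis
    unfolding support_fun_def using assms by (intro cSUP_upper) auto
qed

lemma support_fun_le:
  assumes "K \<noteq> {}" "\<And>x. x \<in> K \<Longrightarrow> v \<bullet> x \<le> b"
  shows "support_fun K v \<le> b"
  unfolding support_fun_def using assms by (intro cSUP_least) auto

text \<open>
  A supremum of functions that are linear with slope bounded by the largest norm in
  \<open>K\<close> is Lipschitz.
\<close>

lemma continuous_on_support_fun:
  fixes K :: "'a::real_inner set"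
  assumes "compact K" "K \<noteq> {}"
  shows "continuous_on A (support_fun K)"
proof -
  obtain R where R: "0 < R" "\<And>x. x \<in> K \<Longrightarrow> norm x < R"
    using compact_imp_bounded[OF assms(1)] bounded_pos_less by blast
  have le: "support_fun K v \<le> support_fun K w + R * dist v w" for v w
  proof (rule support_fun_le[OF assms(2)])
    fix x assume "x \<in> K"
    have "v \<bullet> x = w \<bullet> x + (v - w) \<bullet> x" by (simp add: inner_diff_left)
    also have "(v - w) \<bullet> x \<le> norm (v - w) * norm x" by (rule norm_cauchy_schwarz)
    also have "\<dots> \<le> norm (v - w) * R"
      using R(2)[OF \<open>x \<in> K\<close>] by (intro mult_left_mono) auto
    finally show "v \<bullet> x \<le> support_fun K w + R * dist v w"
      using inner_le_support_fun[OF assms(1) \<open>x \<in> K\<close>, of w] by (simp add: dist_norm mult.commute)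
  qed
  have "dist (support_fun K v) (support_fun K w) \<le> R * dist v w" for v w
    using le[of v w] le[of w v] by (simp add: dist_real_def dist_commute abs_le_iff)
  then have "R-lipschitz_on UNIV (support_fun K)"
    using R by (intro lipschitz_onI) auto
  then show ?thesis
    using lipschitz_on_continuous_on continuous_on_subset by blast
qed

lemma support_fun_bounded_below:
  fixes K :: "'a::euclidean_space set"
  assumes "compact K" "0 \<in> interior K"
  obtains r where "0 < r" "\<And>v. norm v = 1 \<Longrightarrow> r \<le> support_fun K v"
proof -
  obtain r where r: "0 < r" "ball 0 r \<subseteq> K"
    using assms(2) by (auto simp: mem_interior)
  have "r / 2 \<le> support_fun K v" if "norm v = 1" for v
  proof -
    have "(r/2) *\<^sub>R v \<in> K" using r that by (auto simp: subset_iff)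
    from inner_le_support_fun[OF assms(1) this, of v] show ?thesis
      using that by (simp add: norm_eq_1)
  qed
  then show ?thesis using that[of "r/2"] r by auto
qed

lemma support_fun_pos:
  fixes K :: "'a::euclidean_space set"
  assumes "compact K" "0 \<in> interior K" "norm v = 1"
  shows "0 < support_fun K v"
  using assms support_fun_bounded_below by (metis less_le_trans)

lemma support_fun_dilate:
  assumes "compact L" "L \<noteq> {}" "0 < c"
  shows "support_fun ((*\<^sub>R) c ` L) v = c * support_fun L v"
proof (rule antisym)
  show "support_fun ((*\<^sub>R) c ` L) v \<le> c * support_fun L v"
    using assms inner_le_support_fun[of L _ v] by (intro support_fun_le) auto
  have "support_fun L v \<le> support_fun ((*\<^sub>R) c ` L) v / c"
  proof (rule support_fun_le[OF assms(2)])
    fix x assume "x \<in> L"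
    then show "v \<bullet> x \<le> support_fun ((*\<^sub>R) c ` L) v / c"
      using inner_le_support_fun[OF compact_scaling[OF assms(1), of c], of "c *\<^sub>R x" v] \<open>0 < c\<close>
      by (simp add: field_simps)
  qed
  then show "c * support_fun L v \<le> support_fun ((*\<^sub>R) c ` L) v"
    using assms by (simp add: field_simps)
qed

section \<open>Outer normals and the Minkowski functional\<close>

definition outer_normal :: "'a::real_inner set \<Rightarrow> 'a \<Rightarrow> 'a \<Rightarrow> bool" where
  "outer_normal K u v \<longleftrightarrow> norm v = 1 \<and> (radial_fun K u *\<^sub>R u) \<bullet> v = support_fun K v"

text \<open>
  The boundary point in direction \<open>u\<close> is not interior, so \<open>K\<close> has a supporting hyperplane there.
\<close>

lemma outer_normal_exists:
  fixes K :: "'a::euclidean_space set"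
  assumes K: "K \<in> convex_bodies_o" and u: "norm u = 1"
  shows "\<exists>v. outer_normal K u v"
proof -
  let ?x = "radial_fun K u *\<^sub>R u"
  note K' = convex_bodyD[OF K]
  have x: "?x \<in> K" using radial_fun_mem K' u by blast
  have "?x \<notin> interior K"
  proof
    assume "?x \<in> interior K"
    then obtain e where e: "0 < e" "ball ?x e \<subseteq> K" by (auto simp: mem_interior)
    have "(radial_fun K u + e/2) *\<^sub>R u \<in> K"
      using e u by (intro subsetD[OF e(2)]) (auto simp: dist_norm scaleR_add_left)
    then have "radial_fun K u + e/2 \<le> radial_fun K u"
      using e K' u radial_fun_mem(2)[of K u] by (intro radial_fun_ge) auto
    then show False using e by simp
  qed
  then have "?x \<notin> rel_interior K"
    using rel_interior_nonempty_interior[of K] K' by auto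
  then obtain a where a: "a \<noteq> 0" "\<And>y. y \<in> K \<Longrightarrow> a \<bullet> ?x \<le> a \<bullet> y"
    using supporting_hyperplane_rel_boundary[OF K'(2) x] by metis
  have "support_fun K (- sgn a) \<le> - sgn a \<bullet> ?x"
    using a K' by (intro support_fun_le) (auto simp: sgn_div_norm divide_simps)
  with inner_le_support_fun[OF K'(1) x, of "- sgn a"]
  have "outer_normal K u (- sgn a)"
    using a by (simp add: outer_normal_def norm_sgn inner_commute)
  then show ?thesis by blast
qed

text \<open>
  This is the only geometric inequality in the argument: the point of \<open>L\<close> in direction \<open>u\<close>
  lies below the supporting hyperplane of \<open>L\<close> with normal \<open>v\<close>, while the point of \<open>K\<close> in
  direction \<open>u\<close> lies on the supporting hyperplane of \<open>K\<close> with that normal.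
\<close>

lemma radial_quotient_le_support_quotient:
  fixes K :: "'a::euclidean_space set"
  assumes K: "K \<in> convex_bodies_o" and L: "L \<in> convex_bodies_o"
    and u: "norm u = 1" and v: "outer_normal K u v"
  shows "radial_fun L u / radial_fun K u \<le> support_fun L v / support_fun K v"
proof -
  note K' = convex_bodyD[OF K] and L' = convex_bodyD[OF L]
  have pos: "0 < radial_fun K u" "0 < support_fun K v"
    using radial_fun_pos support_fun_pos K' u v by (auto simp: outer_normal_def)
  have h: "support_fun K v = radial_fun K u * (u \<bullet> v)"
    using v by (simp add: outer_normal_def)
  have "radial_fun L u * (u \<bullet> v) \<le> support_fun L v"
    using inner_le_support_fun[OF L'(1) radial_fun_mem(1)[OF L'(1,4) u], of v]
    by (simp add: inner_commute)
  moreover have "u \<bullet> v > 0" using pos h by (simp add: zero_less_mult_iff)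
  ultimately show ?thesis using pos unfolding h by (simp add: field_simps)
qed

text \<open>
  This is the Minkowski functional of \<open>K\<close>. Writing it as a supremum of linear functionals,
  one for each supporting half-space, makes convexity and Lipschitz continuity immediate, and
  exhibits every outer normal as a subgradient.
\<close>

definition polar_gauge :: "'a::euclidean_space set \<Rightarrow> 'a \<Rightarrow> real" where
  "polar_gauge K x = (SUP v\<in>sphere 0 1. (v \<bullet> x) / support_fun K v)"

context
  fixes K :: "'a::euclidean_space set"
  assumes K: "K \<in> convex_bodies_o"
begin

lemma inner_quotient_bound:
  obtains B where "0 < B" "\<And>v x. norm v = 1 \<Longrightarrow> (v \<bullet> x) / support_fun K v \<le> B * norm x"
proof -
  obtain r where r: "0 < r" "\<And>v. norm v = 1 \<Longrightarrow> r \<le> support_fun K v"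
    using support_fun_bounded_below convex_bodyD[OF K] by metis
  have "(v \<bullet> x) / support_fun K v \<le> 1 / r * norm x" if v: "norm v = 1" for v x
  proof -
    have "(v \<bullet> x) / support_fun K v \<le> norm x / support_fun K v"
      using r(1) r(2)[OF v] norm_cauchy_schwarz[of v x] v by (intro divide_right_mono) auto
    also have "\<dots> \<le> norm x / r"
      using r(1) r(2)[OF v] by (intro divide_left_mono) auto
    finally show ?thesis by simp
  qed
  then show ?thesis using that[of "1/r"] r by auto
qed

lemma inner_le_gauge:
  assumes "norm v = 1"
  shows "(v \<bullet> x) / support_fun K v \<le> polar_gauge K x"
proof -
  obtain B where "\<And>v x. norm v = 1 \<Longrightarrow> (v \<bullet> x) / support_fun K v \<le> B * norm x"
    using inner_quotient_bound by blast
  then have "bdd_above ((\<lambda>v. (v \<bullet> x) / support_fun K v) ` sphere 0 1)"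
    by (auto intro!: bdd_aboveI[of _ "B * norm x"])
  then show ?thesis
    unfolding polar_gauge_def using assms by (intro cSUP_upper) auto
qed

lemma gauge_le:
  assumes "\<And>v. norm v = 1 \<Longrightarrow> (v \<bullet> x) / support_fun K v \<le> b"
  shows "polar_gauge K x \<le> b"
proof -
  have "sphere (0::'a) 1 \<noteq> {}" by simp
  then show ?thesis unfolding polar_gauge_def using assms by (intro cSUP_least) auto
qed

lemma gauge_scale: 
  assumes "0 < c"
  shows "polar_gauge K (c *\<^sub>R x) = c * polar_gauge K x"
proof -
  have le: "polar_gauge K (d *\<^sub>R y) \<le> d * polar_gauge K y" if "0 < d" for d y
    using inner_le_gauge[of _ y] that by (intro gauge_le) (simp flip: times_divide_eq_right)
  from le[OF assms, of x] le[of "1/c" "c *\<^sub>R x"] assms show ?thesis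
    by (simp add: field_simps)
qed

lemma gauge_add: "polar_gauge K (x + y) \<le> polar_gauge K x + polar_gauge K y"
proof (rule gauge_le)
  fix v :: 'a assume "norm v = 1"
  then show "v \<bullet> (x + y) / support_fun K v \<le> polar_gauge K x + polar_gauge K y"
    using inner_le_gauge[of v x] inner_le_gauge[of v y]
    by (simp add: inner_add_right add_divide_distrib)
qed

lemma continuous_on_gauge: "continuous_on A (polar_gauge K)"
proof -
  obtain B where B: "0 < B" "\<And>x. polar_gauge K x \<le> B * norm x"
    using inner_quotient_bound gauge_le by metis
  have le: "polar_gauge K x - polar_gauge K y \<le> B * dist x y" for x y
    using gauge_add[of y "x - y"] B(2)[of "x - y"] by (simp add: dist_norm)
  have "dist (polar_gauge K x) (polar_gauge K y) \<le> B * dist x y" for x y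
    using le[of x y] le[of y x] by (simp add: dist_real_def dist_commute abs_le_iff)
  then have "B-lipschitz_on UNIV (polar_gauge K)"
    using B by (intro lipschitz_onI) auto
  then show ?thesis
    using lipschitz_on_continuous_on continuous_on_subset by blast
qed

lemma convex_on_gauge: "convex_on UNIV (polar_gauge K)"
proof (rule convex_onI)
  fix t :: real and x y :: 'a assume t: "0 < t" "t < 1"
  show "polar_gauge K ((1 - t) *\<^sub>R x + t *\<^sub>R y) \<le> (1 - t) * polar_gauge K x + t * polar_gauge K y"
    using gauge_add[of "(1 - t) *\<^sub>R x" "t *\<^sub>R y"] t by (simp add: gauge_scale)
qed simp

text \<open>
  An outer normal \<open>v\<close> in direction \<open>u\<close> attains the supremum at \<open>u\<close>, and its value there is
  the reciprocal of the radial function. So \<open>v\<close> divided by its support value is a subgradient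
  of the gauge at \<open>u\<close>.
\<close>

lemma gauge_eq_inner_normal:
  assumes "norm u = 1" "outer_normal K u v"
  shows "polar_gauge K u = (v \<bullet> u) / support_fun K v" "polar_gauge K u = 1 / radial_fun K u"
proof -
  note K' = convex_bodyD[OF K]
  have pos: "0 < radial_fun K u" using radial_fun_pos K' assms by blast
  have hv: "0 < support_fun K v" using support_fun_pos K' assms by (auto simp: outer_normal_def)
  have eq: "(v \<bullet> u) / support_fun K v = 1 / radial_fun K u"
    using assms(2) pos hv unfolding outer_normal_def by (auto simp: field_simps inner_commute)
  have "polar_gauge K u \<le> 1 / radial_fun K u"
  proof (rule gauge_le)
    fix w :: 'a assume w: "norm w = 1"
    have "0 < support_fun K w" using support_fun_pos K' w by blast
    moreover have "w \<bullet> (radial_fun K u *\<^sub>R u) \<le> support_fun K w"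
      using inner_le_support_fun radial_fun_mem(1) K' assms(1) by blast
    ultimately show "(w \<bullet> u) / support_fun K w \<le> 1 / radial_fun K u"
      using pos by (simp add: field_simps)
  qed
  moreover have "(v \<bullet> u) / support_fun K v \<le> polar_gauge K u"
    using inner_le_gauge assms(2) by (auto simp: outer_normal_def)
  ultimately show "polar_gauge K u = (v \<bullet> u) / support_fun K v"
     "polar_gauge K u = 1 / radial_fun K u" using eq by auto
qed

lemma continuous_on_radial_fun: "continuous_on (sphere 0 1) (radial_fun K)"
proof -
  note K' = convex_bodyD[OF K]
  have eq: "radial_fun K u = 1 / polar_gauge K u" if "norm u = 1" for u
    using gauge_eq_inner_normal outer_normal_exists[OF K that] that by fastforce
  have "polar_gauge K u \<noteq> 0" if "norm u = 1" for u
    using eq[OF that] radial_fun_pos[OF K'(1,3) that] by auto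
  then have "continuous_on (sphere 0 1) (\<lambda>u. 1 / polar_gauge K u)"
    by (intro continuous_intros continuous_on_gauge) auto
  then show ?thesis using eq by (subst continuous_on_cong[OF refl, of _ _ "\<lambda>u. 1 / polar_gauge K u"]) auto
qed

end

section \<open>Uniqueness of outer normals in almost every direction\<close>

text \<open>
  If the one-sided derivatives of a convex function at \<open>x\<close> in direction \<open>b\<close> differ, every slope
  \<open>q\<close> strictly between them puts \<open>x\<close> into this set: along the line through \<open>x\<close>, the supporting
  line of slope \<open>q\<close> touches the graph only at \<open>x\<close>.
\<close>

definition kink :: "('a::real_vector \<Rightarrow> real) \<Rightarrow> 'a \<Rightarrow> real \<Rightarrow> 'a set" where
  "kink g b q = {x. \<forall>t. t \<noteq> 0 \<longrightarrow> g x + q * t < g (x + t *\<^sub>R b)}"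

text \<open>
  By convexity the strict inequality propagates outwards from \<open>x\<close>, so it is enough to ask for
  it at the parameters \<open>1 / j\<close> and \<open>- 1 / j\<close>; this leaves a countable intersection of open sets.
\<close>

lemma kink_borel:
  fixes g :: "'a::euclidean_space \<Rightarrow> real"
  assumes convex: "convex_on UNIV g" and cont: "continuous_on UNIV g"
  shows "kink g b q \<in> sets borel"
proof -
  define A where "A s = {x. g x + q * s < g (x + s *\<^sub>R b)}" for s :: real
  have openA: "open (A s)" for s
    unfolding A_def
    by (intro open_Collect_less continuous_intros continuous_on_compose2[OF cont]) auto
  have key: "x \<in> A t" if "x \<in> A s" "t \<noteq> 0" "0 < s / t" "s / t \<le> 1" for x s t
  proof -
    have "g ((1 - s / t) *\<^sub>R x + (s / t) *\<^sub>R (x + t *\<^sub>R b))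
        \<le> (1 - s / t) * g x + (s / t) * g (x + t *\<^sub>R b)"
      using that by (intro convex_onD[OF convex]) auto
    moreover have "(1 - s / t) *\<^sub>R x + (s / t) *\<^sub>R (x + t *\<^sub>R b) = x + s *\<^sub>R b"
      using that by (simp add: algebra_simps)
    ultimately have "g x + q * s < (1 - s / t) * g x + (s / t) * g (x + t *\<^sub>R b)"
      using that(1) by (simp add: A_def)
    moreover have "q * s = (s / t) * (q * t)" using that by simp
    ultimately have "(s / t) * (g x + q * t) < (s / t) * g (x + t *\<^sub>R b)"
      by (simp only: ring_distribs)
    then show ?thesis using that(3) by (simp only: A_def mem_Collect_eq mult_less_cancel_left_pos)
  qed
  have "kink g b q = (\<Inter>j::nat. A (1 / Suc j) \<inter> A (- (1 / Suc j)))"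
  proof (intro set_eqI iffI)
    fix x assume x: "x \<in> (\<Inter>j::nat. A (1 / Suc j) \<inter> A (- (1 / Suc j)))"
    have "x \<in> A t" if "t \<noteq> 0" for t
    proof -
      have "0 < \<bar>t\<bar>" using that by simp
      then obtain j :: nat where j: "1 / Suc j < \<bar>t\<bar>" by (rule nat_approx_posE)
      have "x \<in> A (1 / Suc j)" "x \<in> A (- (1 / Suc j))" using x by blast+
      show ?thesis
      proof (cases "0 < t")
        case True
        then show ?thesis using j by (intro key[OF \<open>x \<in> A (1 / Suc j)\<close>]) (auto simp: field_simps)
      next
        case False
        then show ?thesis using j that
          by (intro key[OF \<open>x \<in> A (- (1 / Suc j))\<close>]) (auto simp: field_simps)
      qed
    qed
    then show "x \<in> kink g b q" by (auto simp: kink_def A_def)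
  next
    fix x assume x: "x \<in> kink g b q"
    have "x \<in> A t" if "t \<noteq> 0" for t using x that by (simp add: kink_def A_def)
    then show "x \<in> (\<Inter>j::nat. A (1 / Suc j) \<inter> A (- (1 / Suc j)))" by simp
  qed
  moreover have "A s \<in> sets borel" for s using openA by (rule borel_open)
  ultimately show ?thesis by auto
qed

text \<open>
  Averaging the translates of \<open>N\<close> along a unit piece of direction \<open>b\<close> does not change the
  measure. By Tonelli the average is also the integral of the lengths in which lines meet \<open>N\<close>,
  all of which vanish.
\<close>

lemma null_if_lines_countable:
  fixes N :: "'a::euclidean_space set"
  assumes N [measurable]: "N \<in> sets borel" and lines: "\<And>x. countable {t::real. x + t *\<^sub>R b \<in> N}"
  shows "N \<in> null_sets lborel"
proof -
  have pair: "pair_sigma_finite (lborel :: 'a measure) (lborel :: real measure)"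
    by (intro pair_sigma_finite.intro lborel.sigma_finite_measure_axioms)
  let ?f = "\<lambda>(x::'a) (t::real). indicator N (x + t *\<^sub>R b) * indicator {0..1} t :: ennreal"
  have meas: "case_prod ?f \<in> borel_measurable (lborel \<Otimes>\<^sub>M lborel)" by measurable
  have "(\<integral>\<^sup>+ t. ?f x t \<partial>lborel) = 0" for x
  proof -
    have "AE t in lborel. t \<notin> {t. x + t *\<^sub>R b \<in> N}"
      by (intro AE_not_in countable_imp_null_set_lborel lines)
    then have "(\<integral>\<^sup>+ t. ?f x t \<partial>lborel) = (\<integral>\<^sup>+ t. 0 \<partial>(lborel::real measure))"
      by (intro nn_integral_cong_AE) (auto split: split_indicator)
    then show ?thesis by simp
  qed
  then have "(\<integral>\<^sup>+ x. \<integral>\<^sup>+ t. ?f x t \<partial>lborel \<partial>lborel) = 0" by simp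
  moreover have "(\<integral>\<^sup>+ t. \<integral>\<^sup>+ x. ?f x t \<partial>lborel \<partial>lborel) = emeasure lborel N"
  proof -
    have "(\<integral>\<^sup>+ x. indicator N (x + t *\<^sub>R b) \<partial>lborel) = emeasure lborel N" for t
    proof -
      have "emeasure lborel N = (\<integral>\<^sup>+ x. indicator N x \<partial>distr lborel borel ((+) (t *\<^sub>R b)))"
        by (simp add: lborel_distr_plus)
      also have "\<dots> = (\<integral>\<^sup>+ x. indicator N (t *\<^sub>R b + x) \<partial>lborel)"
        by (subst nn_integral_distr) auto
      finally show ?thesis by (simp add: add.commute)
    qed
    then have "(\<integral>\<^sup>+ t. \<integral>\<^sup>+ x. ?f x t \<partial>lborel \<partial>lborel)
        = (\<integral>\<^sup>+ t. emeasure lborel N * indicator {0..1::real} t \<partial>lborel)"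
      by (intro nn_integral_cong) (subst nn_integral_multc, auto)
    also have "\<dots> = emeasure lborel N" by (subst nn_integral_cmult_indicator) auto
    finally show ?thesis .
  qed
  ultimately have "emeasure lborel N = 0" using pair_sigma_finite.Fubini'[OF pair meas] by simp
  then show ?thesis by (auto simp: null_sets_def)
qed

text \<open>
  A line in direction \<open>b\<close> meets a kink set at most once: of two such points, the
  graph over each would lie strictly above the line of slope \<open>q\<close> through the other.
\<close>

lemma kink_null:
  fixes g :: "'a::euclidean_space \<Rightarrow> real"
  assumes "convex_on UNIV g" "continuous_on UNIV g"
  shows "kink g b q \<in> null_sets lborel"
proof (rule null_if_lines_countable[OF kink_borel[OF assms]])
  fix x
  have unique: "s = t" if "x + s *\<^sub>R b \<in> kink g b q" "x + t *\<^sub>R b \<in> kink g b q" for s t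
  proof (rule ccontr)
    assume "s \<noteq> t"
    have "g (x + s *\<^sub>R b) + q * (t - s) < g (x + s *\<^sub>R b + (t - s) *\<^sub>R b)"
      using that(1) \<open>s \<noteq> t\<close> by (simp add: kink_def del: add.assoc)
    moreover have "g (x + t *\<^sub>R b) + q * (s - t) < g (x + t *\<^sub>R b + (s - t) *\<^sub>R b)"
      using that(2) \<open>s \<noteq> t\<close> by (simp add: kink_def)
    ultimately show False by (simp add: algebra_simps)
  qed
  show "countable {t. x + t *\<^sub>R b \<in> kink g b q}"
  proof (cases "\<exists>s. x + s *\<^sub>R b \<in> kink g b q")
    case True
    then obtain s where "x + s *\<^sub>R b \<in> kink g b q" by blast
    then have "{t. x + t *\<^sub>R b \<in> kink g b q} \<subseteq> {s}" using unique by blast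
    then show ?thesis by (rule countable_subset) simp
  qed simp
qed

text \<open>
  Countably many pairs \<open>(b, q)\<close> suffice: two distinct subgradients differ in some coordinate
  direction, and a rational slope separates the two coordinates.
\<close>

definition singular_directions :: "'a::euclidean_space set \<Rightarrow> 'a set" where
  "singular_directions K = (\<Union>b\<in>Basis. \<Union>q\<in>\<rat>. kink (polar_gauge K) b q)"

context
  fixes K :: "'a::euclidean_space set"
  assumes K: "K \<in> convex_bodies_o"
begin

lemma singular_directions_null: "singular_directions K \<in> null_sets lborel"
  unfolding singular_directions_def
  by (intro null_sets_UN' kink_null countable_rat countable_finite finite_Basis
      convex_on_gauge[OF K] continuous_on_gauge[OF K])

lemma singular_directions_cone:
  assumes "x \<in> singular_directions K" "0 < c"
  shows "c *\<^sub>R x \<in> singular_directions K"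
proof -
  have "c *\<^sub>R x \<in> kink (polar_gauge K) b q" if x: "x \<in> kink (polar_gauge K) b q" for b q
    unfolding kink_def
  proof (intro CollectI allI impI)
    fix t :: real assume "t \<noteq> 0"
    then have "polar_gauge K x + q * (t / c) < polar_gauge K (x + (t / c) *\<^sub>R b)"
      using x \<open>0 < c\<close> unfolding kink_def by (auto simp del: times_divide_eq_right)
    then have "c * (polar_gauge K x + q * (t / c)) < polar_gauge K (c *\<^sub>R (x + (t / c) *\<^sub>R b))"
      using \<open>0 < c\<close> by (simp add: gauge_scale[OF K] mult_less_cancel_left_pos)
    moreover have "c *\<^sub>R (x + (t / c) *\<^sub>R b) = c *\<^sub>R x + t *\<^sub>R b"
      using \<open>0 < c\<close> by (simp add: scaleR_add_right)
    ultimately show "polar_gauge K (c *\<^sub>R x) + q * t < polar_gauge K (c *\<^sub>R x + t *\<^sub>R b)"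
      using \<open>0 < c\<close> by (simp add: gauge_scale[OF K] distrib_left)
  qed
  then show ?thesis using assms unfolding singular_directions_def by blast
qed

text \<open>
  Two distinct outer normals at the same boundary point give two distinct subgradients of the
  gauge, hence a kink in some coordinate direction. Coordinate directions detect all failures of
  uniqueness, which reduces an n-dimensional statement to functions of one variable.
\<close>

lemma outer_normal_unique:
  assumes u: "norm u = 1" and reg: "u \<notin> singular_directions K"
    and v: "outer_normal K u v" and w: "outer_normal K u w"
  shows "v = w"
proof (rule ccontr)
  assume "v \<noteq> w"
  note K' = convex_bodyD[OF K]
  define s where "s v = (1 / support_fun K v) *\<^sub>R v" for v
  have unit: "norm v = 1" "norm w = 1" using v w by (auto simp: outer_normal_def)
  have pos: "0 < support_fun K v" "0 < support_fun K w" using support_fun_pos K' unit by blast+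
  have "s v \<noteq> s w"
  proof
    assume eq: "s v = s w"
    then have "norm (s v) = norm (s w)" by simp
    then have "support_fun K v = support_fun K w" using pos unit by (simp add: s_def)
    then show False using eq pos \<open>v \<noteq> w\<close> by (simp add: s_def)
  qed
  then obtain b where b: "b \<in> Basis" "s v \<bullet> b \<noteq> s w \<bullet> b" using euclidean_eqI by blast
  have kink: "\<exists>q\<in>\<rat>. u \<in> kink (polar_gauge K) b q"
    if v: "outer_normal K u v" and w: "outer_normal K u w" and less: "s v \<bullet> b < s w \<bullet> b" for v w
  proof -
    obtain q where q: "q \<in> \<rat>" "s v \<bullet> b < q" "q < s w \<bullet> b"
      using Rats_dense_in_real[OF less] by blast
    have sub: "polar_gauge K u + t * (s z \<bullet> b) \<le> polar_gauge K (u + t *\<^sub>R b)"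
      if z: "outer_normal K u z" for z t
    proof -
      have "polar_gauge K u = s z \<bullet> u"
        using gauge_eq_inner_normal(1)[OF K u z] by (simp add: s_def)
      then have "polar_gauge K u + t * (s z \<bullet> b) = s z \<bullet> (u + t *\<^sub>R b)"
        by (simp add: inner_add_right)
      also have "\<dots> \<le> polar_gauge K (u + t *\<^sub>R b)"
        using inner_le_gauge[OF K, of z] z by (simp add: s_def outer_normal_def)
      finally show ?thesis .
    qed
    have "u \<in> kink (polar_gauge K) b q"
      unfolding kink_def
    proof (intro CollectI allI impI)
      fix t :: real assume "t \<noteq> 0"
      then consider "0 < t" | "t < 0" by linarith
      then show "polar_gauge K u + q * t < polar_gauge K (u + t *\<^sub>R b)"
      proof cases
        case 1
        then have "q * t < t * (s w \<bullet> b)" using q by (simp add: mult.commute)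
        then show ?thesis using sub[OF w, of t] by linarith
      next
        case 2
        then have "q * t < t * (s v \<bullet> b)" using q by (simp add: mult.commute)
        then show ?thesis using sub[OF v, of t] by linarith
      qed
    qed
    then show ?thesis using q by blast
  qed
  have "\<exists>q\<in>\<rat>. u \<in> kink (polar_gauge K) b q"
    using kink[OF v w] kink[OF w v] b(2) by linarith
  then show False using reg b(1) by (auto simp: singular_directions_def)
qed

end

section \<open>Spherical Lebesgue measure\<close>

abbreviation borel_sphere :: "'a::euclidean_space measure" where
  "borel_sphere \<equiv> restrict_space borel (sphere 0 1)"

lemma sphere_in_borel [simp, measurable]: "sphere (0::'a::euclidean_space) 1 \<in> sets borel"
  by (simp add: borel_closed)

lemma sets_borel_sphere_iff:
  "E \<in> sets borel_sphere \<longleftrightarrow> E \<subseteq> sphere 0 1 \<and> E \<in> sets borel"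
  by (rule sets_restrict_space_iff) simp

lemma sgn_measurable [measurable]: "(sgn :: 'a::euclidean_space \<Rightarrow> 'a) \<in> borel_measurable borel"
  unfolding sgn_div_norm[abs_def] by measurable

lemma sgn_measurable_sphere:
  "sgn \<in> restrict_space lborel (ball 0 1 - {0}) \<rightarrow>\<^sub>M (borel_sphere :: 'a::euclidean_space measure)"
  by (intro measurable_restrict_space2 measurable_restrict_space1)
     (auto simp: space_restrict_space norm_sgn)

lemma space_spherical [simp]: "space spherical_lebesgue = sphere 0 1"
  by (simp add: spherical_lebesgue_def space_scale_measure space_restrict_space)

lemma sets_spherical: "E \<in> sets borel_sphere \<Longrightarrow> E \<in> sets spherical_lebesgue"
  by (simp add: spherical_lebesgue_def)

lemma measurable_spherical:
  "f \<in> borel_sphere \<rightarrow>\<^sub>M N \<Longrightarrow> f \<in> spherical_lebesgue \<rightarrow>\<^sub>M N"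
  unfolding spherical_lebesgue_def
  by (intro measurable_completion) (simp cong: measurable_cong_sets)

lemma continuous_measurable_spherical:
  "continuous_on (sphere 0 1) f \<Longrightarrow> f \<in> borel_measurable spherical_lebesgue"
  by (intro measurable_spherical borel_measurable_continuous_on_restrict)

lemma nn_integral_spherical:
  fixes f :: "'a::euclidean_space \<Rightarrow> ennreal"
  assumes "f \<in> borel_measurable borel_sphere"
  shows "(\<integral>\<^sup>+u. f u \<partial>spherical_lebesgue)
    = of_nat DIM('a) * (\<integral>\<^sup>+x\<in>ball 0 1 - {0}. f (sgn x) \<partial>lborel)"
  unfolding spherical_lebesgue_def nn_integral_completion
  using assms
  by (simp add: nn_integral_scale_measure nn_integral_distr[OF sgn_measurable_sphere]
      nn_integral_restrict_space)

lemma cone_in_borel: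
  assumes "E \<in> sets borel"
  shows "{x \<in> ball (0::'a::euclidean_space) 1 - {0}. sgn x \<in> E} \<in> sets borel"
proof -
  have "{x \<in> ball 0 1 - {0}. sgn x \<in> E} = (ball (0::'a) 1 - {0}) \<inter> (sgn -` E \<inter> space borel)"
    by auto
  then show ?thesis
    using measurable_sets[OF sgn_measurable assms] by (simp add: sets.Int sets.Diff)
qed

lemma emeasure_spherical:
  fixes E :: "'a::euclidean_space set"
  assumes "E \<in> sets borel_sphere"
  shows "emeasure spherical_lebesgue E
    = of_nat DIM('a) * emeasure lborel {x \<in> ball 0 1 - {0}. sgn x \<in> E}"
proof -
  have E: "E \<in> sets borel" using assms by (simp add: sets_borel_sphere_iff)
  have "emeasure spherical_lebesgue E = (\<integral>\<^sup>+u. indicator E u \<partial>spherical_lebesgue)"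
    using sets_spherical[OF assms] by simp
  also have "\<dots> = of_nat DIM('a) * (\<integral>\<^sup>+x\<in>ball 0 1 - {0}. indicator E (sgn x) \<partial>lborel)"
    using assms by (intro nn_integral_spherical) auto
  also have "(\<integral>\<^sup>+x\<in>ball 0 1 - {0}. indicator E (sgn x) \<partial>lborel)
      = (\<integral>\<^sup>+x. indicator {x \<in> ball 0 1 - {0}. sgn x \<in> E} x \<partial>lborel)"
    by (intro nn_integral_cong) (auto split: split_indicator)
  also have "\<dots> = emeasure lborel {x \<in> ball 0 1 - {0}. sgn x \<in> E}"
    using cone_in_borel[OF E] by (intro nn_integral_indicator) simp
  finally show ?thesis .
qed

lemma finite_measure_spherical: "finite_measure (spherical_lebesgue :: 'a::euclidean_space measure)"
proof (rule finite_measureI)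
  have "emeasure lborel {x \<in> ball 0 1 - {0}. sgn x \<in> sphere (0::'a) 1} \<le> emeasure lborel (ball (0::'a) 1)"
    by (intro emeasure_mono) auto
  also have "\<dots> < \<infinity>" by (intro emeasure_bounded_finite) auto
  finally show "emeasure spherical_lebesgue (space (spherical_lebesgue :: 'a measure)) \<noteq> \<infinity>"
    by (simp add: emeasure_spherical sets_borel_sphere_iff ennreal_mult_eq_top_iff)
qed

text \<open>
  For a set invariant under positive scaling, the cone over its trace on the sphere is contained
  in the set itself.
\<close>

lemma null_set_spherical_if_cone_null:
  fixes N :: "'a::euclidean_space set"
  assumes "N \<in> null_sets lborel" and cone: "\<And>c x. x \<in> N \<Longrightarrow> 0 < c \<Longrightarrow> c *\<^sub>R x \<in> N"
  shows "N \<inter> sphere 0 1 \<in> null_sets spherical_lebesgue"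
proof -
  have N: "N \<in> sets borel" using assms by auto
  then have E: "N \<inter> sphere 0 1 \<in> sets borel_sphere" by (simp add: sets_borel_sphere_iff)
  have "x \<in> N" if "sgn x \<in> N" "x \<noteq> 0" for x
    using cone[OF that(1), of "norm x"] that(2) by (simp add: sgn_div_norm)
  then have "emeasure lborel {x \<in> ball 0 1 - {0}. sgn x \<in> N \<inter> sphere 0 1} \<le> emeasure lborel N"
    using N by (intro emeasure_mono) auto
  also have "\<dots> = 0" using assms by auto
  finally show ?thesis
    using E by (auto simp: null_sets_def emeasure_spherical sets_spherical)
qed

text \<open>
  A nonempty relatively open subset of the sphere spans a nonempty open cone, which has positive
  volume.
\<close>

lemma continuous_eq_const_if_AE_spherical:
  fixes f :: "'a::euclidean_space \<Rightarrow> real"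
  assumes f: "continuous_on (sphere 0 1) f" and ae: "AE u in spherical_lebesgue. f u = c"
    and u: "norm u = 1"
  shows "f u = c"
proof (rule ccontr)
  assume neq: "f u \<noteq> c"
  let ?E = "{v \<in> sphere 0 1. f v \<noteq> c}"
  let ?O = "{x \<in> ball 0 1 - {0}. sgn x \<in> ?E}"
  have sgn_unit: "sgn x \<in> sphere 0 1" if "x \<noteq> 0" for x :: 'a using that by (simp add: norm_sgn)
  have "closed {v \<in> sphere 0 1. f v = c}"
    by (intro continuous_closed_preimage_constant f) simp
  moreover have "?E = sphere 0 1 - {v \<in> sphere 0 1. f v = c}" by auto
  ultimately have E: "?E \<in> sets borel_sphere"
    by (simp add: sets_borel_sphere_iff borel_closed subset_iff)
  have "continuous_on (ball 0 1 - {0::'a}) (\<lambda>x. f (sgn x))"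
  proof (rule continuous_on_compose2[OF f])
    show "continuous_on (ball 0 1 - {0::'a}) sgn"
      by (intro continuous_on_sgn continuous_on_id) auto
  qed (use sgn_unit in blast)
  then have "open ((ball 0 1 - {0}) \<inter> (\<lambda>x. f (sgn x)) -` (- {c}))"
    by (intro continuous_open_preimage) (auto intro: open_delete)
  moreover have "(ball 0 1 - {0}) \<inter> (\<lambda>x. f (sgn x)) -` (- {c}) = ?O"
    by (auto simp: norm_sgn)
  ultimately have "open ?O" by simp
  moreover have "(1/2) *\<^sub>R u \<in> ?O" using u neq by (auto simp: sgn_scaleR sgn_div_norm)
  ultimately have "?O \<notin> null_sets lborel"
    using open_not_negligible negligible_iff_null_sets null_sets_completionI by blast
  moreover have "emeasure spherical_lebesgue ?E = 0"
    using ae AE_iff_measurable[OF sets_spherical[OF E], of "\<lambda>u. f u = c"] by simp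
  then have "emeasure lborel ?O = 0"
    using emeasure_spherical[OF E] by simp
  then have "?O \<in> null_sets lborel"
    unfolding null_sets_def using borel_open[OF \<open>open ?O\<close>] by (simp only: mem_Collect_eq sets_lborel simp_thms)
  ultimately show False by contradiction
qed

section \<open>The radial Gauss map and the dual curvature measure\<close>

text \<open>
  On the null cone of singular directions the value is one fixed unit vector. A choice that
  depends on the direction there could destroy Borel measurability.
\<close>

definition radial_gauss_map :: "'a::euclidean_space set \<Rightarrow> 'a \<Rightarrow> 'a" where
  "radial_gauss_map K u =
     (if u \<in> singular_directions K then SOME v. v \<in> sphere 0 1 else SOME v. outer_normal K u v)"

context
  fixes K :: "'a::euclidean_space set"
  assumes K: "K \<in> convex_bodies_o"
begin

lemma AE_regular_direction: "AE u in spherical_lebesgue. u \<notin> singular_directions K"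
proof -
  have "singular_directions K \<inter> sphere 0 1 \<in> null_sets spherical_lebesgue"
    by (intro null_set_spherical_if_cone_null singular_directions_null singular_directions_cone K)
  then show ?thesis by (rule AE_I'[of _ _ "\<lambda>u. u \<notin> singular_directions K"]) auto
qed

lemma radial_gauss_map_outer_normal:
  assumes "norm u = 1" "u \<notin> singular_directions K"
  shows "outer_normal K u (radial_gauss_map K u)"
  using someI_ex[OF outer_normal_exists[OF K assms(1)]] assms by (simp add: radial_gauss_map_def)

lemma norm_radial_gauss_map:
  assumes "norm u = 1"
  shows "norm (radial_gauss_map K u) = 1"
proof (cases "u \<in> singular_directions K")
  case True
  have "\<exists>v::'a. v \<in> sphere 0 1" using assms by auto
  from someI_ex[OF this] show ?thesis using True by (simp add: radial_gauss_map_def)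
next
  case False
  then show ?thesis using radial_gauss_map_outer_normal assms by (auto simp: outer_normal_def)
qed

lemma rev_radial_gauss_image_iff:
  assumes "u \<in> sphere 0 1" "u \<notin> singular_directions K" "E \<subseteq> sphere 0 1"
  shows "u \<in> rev_radial_gauss_image K E \<longleftrightarrow> radial_gauss_map K u \<in> E"
proof -
  have u: "norm u = 1" using assms by simp
  have "outer_normal K u v \<longleftrightarrow> v = radial_gauss_map K u" for v
    using radial_gauss_map_outer_normal[OF u assms(2)] outer_normal_unique[OF K u assms(2)] by blast
  moreover have "u \<in> rev_radial_gauss_image K E \<longleftrightarrow> (\<exists>v\<in>E. outer_normal K u v)"
    using assms(1,3) by (fastforce simp: rev_radial_gauss_image_def outer_normal_def)
  ultimately show ?thesis by simp
qed

text \<open>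
  The pairs \<open>(u, v)\<close> with \<open>v\<close> an outer normal in direction \<open>u\<close> form a compact set, because the
  radial and support functions are continuous; project it to its first component.
\<close>

lemma compact_rev_radial_gauss_image:
  assumes C: "closed C"
  shows "compact (rev_radial_gauss_image K (C \<inter> sphere 0 1))"
proof -
  note K' = convex_bodyD[OF K]
  let ?D = "sphere 0 1 \<times> (C \<inter> sphere 0 1) :: ('a \<times> 'a) set"
  let ?F = "\<lambda>z. (radial_fun K (fst z) *\<^sub>R fst z) \<bullet> snd z - support_fun K (snd z)"
  have D: "compact ?D" by (intro compact_Times closed_Int_compact C) auto
  have "continuous_on ?D ?F"
    using K'
    by (intro continuous_intros continuous_on_compose2[OF continuous_on_radial_fun[OF K]]
        continuous_on_compose2[OF continuous_on_support_fun[of K UNIV]]) auto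
  then have "closed {z \<in> ?D. ?F z = 0}"
    by (intro continuous_closed_preimage_constant compact_imp_closed D)
  then have "compact {z \<in> ?D. ?F z = 0}"
    using compact_Int_closed[OF D] by (metis (no_types, lifting) Int_absorb1 mem_Collect_eq subsetI)
  then have "compact (fst ` {z \<in> ?D. ?F z = 0})"
    by (intro compact_continuous_image continuous_intros)
  moreover have "fst ` {z \<in> ?D. ?F z = 0} = rev_radial_gauss_image K (C \<inter> sphere 0 1)"
    by (force simp: rev_radial_gauss_image_def image_iff)
  ultimately show ?thesis by simp
qed

text \<open>
  It suffices to look at preimages of closed sets. Off the Borel set of singular directions these
  coincide with the reverse images of closed sets, which are compact.
\<close>

lemma radial_gauss_map_measurable: "radial_gauss_map K \<in> borel_sphere \<rightarrow>\<^sub>M borel_sphere"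
proof (intro measurable_restrict_space2)
  show "radial_gauss_map K \<in> space borel_sphere \<rightarrow> sphere 0 1"
    using norm_radial_gauss_map by (auto simp: space_restrict_space)
  have sing: "singular_directions K \<in> sets borel"
    using singular_directions_null[OF K] by auto
  define w :: 'a where "w = (SOME v. v \<in> sphere 0 1)"
  show "radial_gauss_map K \<in> borel_measurable borel_sphere"
    unfolding borel_eq_closed[where 'a='a, THEN arg_cong, of "measurable borel_sphere"]
  proof (rule measurable_measure_of)
    fix C :: "'a set" assume "C \<in> Collect closed"
    then have C: "closed C" by simp
    let ?I = "rev_radial_gauss_image K (C \<inter> sphere 0 1)"
    have I: "?I \<in> sets borel"
      by (intro borel_closed compact_imp_closed compact_rev_radial_gauss_image C)
    have "radial_gauss_map K -` C \<inter> sphere 0 1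
      = (?I - singular_directions K) \<union> (if w \<in> C then singular_directions K \<inter> sphere 0 1 else {})"
    proof (intro set_eqI)
      fix u
      show "u \<in> radial_gauss_map K -` C \<inter> sphere 0 1 \<longleftrightarrow>
        u \<in> (?I - singular_directions K) \<union> (if w \<in> C then singular_directions K \<inter> sphere 0 1 else {})"
      proof (cases "u \<in> sphere 0 1 \<and> u \<notin> singular_directions K")
        case True
        then show ?thesis
          using rev_radial_gauss_image_iff[of u "C \<inter> sphere 0 1"] norm_radial_gauss_map[of u] by auto
      next
        case False
        then show ?thesis
          by (auto simp: rev_radial_gauss_image_def radial_gauss_map_def w_def)
      qed
    qed
    moreover have "\<dots> \<in> sets borel" using I sing by auto
    ultimately show "radial_gauss_map K -` C \<inter> space borel_sphere \<in> sets borel_sphere"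
      by (auto simp: space_restrict_space sets_borel_sphere_iff rev_radial_gauss_image_def)
  qed auto
qed

end

text \<open>
  The defining set function agrees with the image measure on the right on all Borel sets, because
  the reverse radial Gauss image of \<open>E\<close> and the preimage of \<open>E\<close> differ only in singular directions.
  In particular the set function is countably additive, so that \<^const>\<open>measure_of\<close> reproduces its
  values.
\<close>

lemma dual_curvature_measure_eq_distr:
  fixes K Q :: "'a::euclidean_space set"
  assumes K: "K \<in> convex_bodies_o" and Q: "Q \<in> star_bodies_o"
  shows "dual_curvature_measure q K Q =
    distr (density spherical_lebesgue (\<lambda>u. ennreal (1 / real DIM('a)) *
        ennreal (radial_fun K u powr q * radial_fun Q u powr (real DIM('a) - q))))
      borel_sphere (radial_gauss_map K)"
    (is "_ = ?D")
proof -
  let ?w = "\<lambda>u. ennreal (radial_fun K u powr q * radial_fun Q u powr (real DIM('a) - q))"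
  let ?S = "spherical_lebesgue :: 'a measure"
  have gauss [measurable]: "radial_gauss_map K \<in> ?S \<rightarrow>\<^sub>M borel_sphere"
    by (intro measurable_spherical radial_gauss_map_measurable K)
  have [measurable]: "radial_fun K \<in> borel_measurable ?S" "radial_fun Q \<in> borel_measurable ?S"
    using continuous_on_radial_fun[OF K] star_bodyD(4)[OF Q]
    by (auto intro: continuous_measurable_spherical)
  have w: "?w \<in> borel_measurable ?S" by measurable
  have "ennreal (1 / real DIM('a)) * (\<integral>\<^sup>+u\<in>rev_radial_gauss_image K E. ?w u \<partial>?S) = emeasure ?D E"
    if E: "E \<in> sets borel_sphere" for E
  proof -
    let ?P = "radial_gauss_map K -` E \<inter> space ?S"
    have P: "?P \<in> sets ?S" using gauss E by (rule measurable_sets)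
    have Esub: "E \<subseteq> sphere 0 1" using E by (simp add: sets_borel_sphere_iff)
    have "AE u in ?S. indicator (rev_radial_gauss_image K E) u = (indicator ?P u :: ennreal)"
      using AE_regular_direction[OF K] AE_space
      by eventually_elim (use rev_radial_gauss_image_iff[OF K _ _ Esub] in \<open>auto split: split_indicator\<close>)
    then have "(\<integral>\<^sup>+u\<in>rev_radial_gauss_image K E. ?w u \<partial>?S) = (\<integral>\<^sup>+u\<in>?P. ?w u \<partial>?S)"
      by (intro nn_integral_cong_AE) auto
    moreover have "emeasure ?D E = (\<integral>\<^sup>+u. ennreal (1 / real DIM('a)) * (?w u * indicator ?P u) \<partial>?S)"
      using E P w by (subst emeasure_distr) (auto simp: emeasure_density mult.assoc)
    moreover have "\<dots> = ennreal (1 / real DIM('a)) * (\<integral>\<^sup>+u\<in>?P. ?w u \<partial>?S)"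
      using P w by (intro nn_integral_cmult) auto
    ultimately show ?thesis by simp
  qed
  moreover have "sigma_sets (sphere 0 1) (sets borel_sphere) = sets (borel_sphere :: 'a measure)"
    using sets.sigma_sets_eq[of "borel_sphere :: 'a measure"] by (simp add: space_restrict_space)
  ultimately have "dual_curvature_measure q K Q = measure_of (sphere 0 1) (sets borel_sphere) (emeasure ?D)"
    unfolding dual_curvature_measure_def
    using sets.space_closed[of "borel_sphere :: 'a measure"]
    by (intro measure_of_eq) (simp_all add: space_restrict_space)
  also have "\<dots> = ?D"
    using measure_of_of_measure[of ?D] by (simp add: space_restrict_space)
  finally show ?thesis .
qed

section \<open>Volume in polar coordinates\<close>

text \<open>
  The origin is left out because \<^const>\<open>sgn\<close> gives it no direction. The strict inequality makes the
  region continuous along increasing sequences of functions.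
\<close>

definition radial_region :: "('a::real_normed_vector \<Rightarrow> real) \<Rightarrow> 'a set" where
  "radial_region f = {x. x \<noteq> 0 \<and> norm x < f (sgn x)}"

lemma radial_region_borel [measurable]:
  assumes [measurable]: "f \<in> borel_measurable borel"
  shows "radial_region f \<in> sets (borel :: 'a::euclidean_space measure)"
  unfolding radial_region_def by measurable

lemma emeasure_radial_region_scale:
  fixes f :: "'a::euclidean_space \<Rightarrow> real"
  assumes f: "f \<in> borel_measurable borel" and c: "0 < c"
  shows "emeasure lborel (radial_region (\<lambda>x. c * f x))
    = ennreal (c ^ DIM('a)) * emeasure lborel (radial_region f)"
proof -
  let ?A = "radial_region (\<lambda>x. c * f x)"
  have A: "?A \<in> sets borel" by (intro radial_region_borel borel_measurable_times f) auto
  have "emeasure lborel ?A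
      = emeasure (density (distr lborel borel (\<lambda>x. 0 + c *\<^sub>R x)) (\<lambda>_. ennreal (\<bar>c\<bar> ^ DIM('a)))) ?A"
    using c by (subst lborel_affine[of c 0]) auto
  also have "\<dots> = ennreal (c ^ DIM('a)) * emeasure lborel ((\<lambda>x. c *\<^sub>R x) -` ?A)"
    using A c by (simp add: emeasure_density nn_integral_cmult emeasure_distr)
  also have "(\<lambda>x. c *\<^sub>R x) -` ?A = radial_region f"
    using c by (auto simp: radial_region_def sgn_scaleR)
  finally show ?thesis .
qed

lemma radial_weight_measurable:
  fixes u :: "'a::euclidean_space \<Rightarrow> real"
  assumes [measurable]: "u \<in> borel_measurable borel"
  shows "(\<lambda>x. ennreal (u (sgn x) ^ k) * indicator (ball 0 1 - {0}) x) \<in> borel_measurable lborel"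
proof (intro borel_measurable_times_ennreal borel_measurable_indicator)
  show "(\<lambda>x. ennreal (u (sgn x) ^ k)) \<in> borel_measurable lborel" by measurable
qed simp

text \<open>
  Integration in polar coordinates. Both sides are homogeneous of degree \<open>n\<close> in \<open>f\<close>, additive over
  functions with disjoint supports, and continuous along increasing sequences, so it is enough to
  compare them for indicator functions, where both sides are the volume of the same sector of the
  unit ball.
\<close>

lemma emeasure_radial_region:
  fixes f :: "'a::euclidean_space \<Rightarrow> real"
  assumes "f \<in> borel_measurable borel" "\<And>x. 0 \<le> f x"
  shows "emeasure lborel (radial_region f)
    = (\<integral>\<^sup>+x\<in>ball 0 1 - {0}. ennreal (f (sgn x) ^ DIM('a)) \<partial>lborel)"
  using assms
proof (induction rule: borel_measurable_induct_real)
  case (set A)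
  have "radial_region (indicator A) = {x \<in> ball 0 1 - {0}. sgn x \<in> A}"
    by (auto simp: radial_region_def indicator_def split: if_splits)
  then have "emeasure lborel (radial_region (indicator A :: 'a \<Rightarrow> real))
      = (\<integral>\<^sup>+x. indicator {x \<in> ball 0 1 - {0}. sgn x \<in> A} x \<partial>lborel)"
    using cone_in_borel[OF set] by simp
  also have "\<dots> = (\<integral>\<^sup>+x\<in>ball 0 1 - {0}. ennreal (indicator A (sgn x) ^ DIM('a)) \<partial>lborel)"
    by (intro nn_integral_cong) (auto simp: indicator_def zero_power)
  finally show ?case .
next
  case (mult u c)
  note [measurable] = mult.hyps(2)
  show ?case
  proof (cases "c = 0")
    case True
    have "radial_region (\<lambda>x::'a. 0) = {}" by (auto simp: radial_region_def)
    then show ?thesis using True by (simp add: zero_power)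
  next
    case False
    have "ennreal ((c * u (sgn x)) ^ DIM('a)) = ennreal (c ^ DIM('a)) * ennreal (u (sgn x) ^ DIM('a))" for x
      using mult.hyps(1,3) by (simp add: power_mult_distrib ennreal_mult)
    then have "(\<integral>\<^sup>+x\<in>ball 0 1 - {0}. ennreal ((c * u (sgn x)) ^ DIM('a)) \<partial>lborel)
        = (\<integral>\<^sup>+x. ennreal (c ^ DIM('a)) * (ennreal (u (sgn x) ^ DIM('a)) * indicator (ball 0 1 - {0}) x) \<partial>lborel)"
      by (simp add: mult.assoc)
    also have "\<dots> = ennreal (c ^ DIM('a)) * (\<integral>\<^sup>+x\<in>ball 0 1 - {0}. ennreal (u (sgn x) ^ DIM('a)) \<partial>lborel)"
      by (intro nn_integral_cmult radial_weight_measurable mult.hyps)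
    finally show ?thesis
      using False mult.hyps(1) mult.IH emeasure_radial_region_scale[OF mult.hyps(2), of c] by simp
  qed
next
  case (add u v)
  note [measurable] = add.hyps(1,3)
  have zero: "u x = 0 \<or> v x = 0" for x using add.hyps(5) by simp
  \<comment> \<open>The n-th power is not additive, but one of the two summands vanishes at each point.\<close>
  have "radial_region (\<lambda>x. v x + u x) = radial_region v \<union> radial_region u"
  proof (intro set_eqI)
    fix x
    show "x \<in> radial_region (\<lambda>x. v x + u x) \<longleftrightarrow> x \<in> radial_region v \<union> radial_region u"
      using zero[of "sgn x"] norm_ge_zero[of x] unfolding radial_region_def by (auto simp: not_less)
  qed
  moreover have "radial_region v \<inter> radial_region u = {}"
  proof -
    have False if "x \<in> radial_region v" "x \<in> radial_region u" for x
      using that zero[of "sgn x"] norm_ge_zero[of x] unfolding radial_region_def by auto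
    then show ?thesis by blast
  qed
  ultimately have "emeasure lborel (radial_region (\<lambda>x. v x + u x))
      = emeasure lborel (radial_region v) + emeasure lborel (radial_region u)"
    by (simp add: plus_emeasure)
  also have "\<dots> = (\<integral>\<^sup>+x. ennreal (v (sgn x) ^ DIM('a)) * indicator (ball 0 1 - {0}) x
      + ennreal (u (sgn x) ^ DIM('a)) * indicator (ball 0 1 - {0}) x \<partial>lborel)"
    unfolding add.IH by (subst nn_integral_add) (simp_all only: radial_weight_measurable add.hyps)
  also have "\<dots> = (\<integral>\<^sup>+x\<in>ball 0 1 - {0}. ennreal ((v (sgn x) + u (sgn x)) ^ DIM('a)) \<partial>lborel)"
  proof (intro nn_integral_cong)
    fix x :: 'a
    show "ennreal (v (sgn x) ^ DIM('a)) * indicator (ball 0 1 - {0}) x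
      + ennreal (u (sgn x) ^ DIM('a)) * indicator (ball 0 1 - {0}) x
      = ennreal ((v (sgn x) + u (sgn x)) ^ DIM('a)) * indicator (ball 0 1 - {0}) x"
      using zero[of "sgn x"] by (auto simp: zero_power)
  qed
  finally show ?case .
next
  case (seq U)
  note [measurable] = seq.hyps(1)
  have lim: "(\<lambda>i. U i x) \<longlonglongrightarrow> f x" for x using seq.hyps(4) by simp
  have inc: "U i x \<le> U j x" if "i \<le> j" for i j x using seq.hyps(3) that by (auto simp: incseq_def le_fun_def)
  have le: "U i x \<le> f x" for i x
    using inc by (intro incseq_le[OF _ lim]) (simp add: incseq_def)
  have "(\<Union>i. radial_region (U i)) = radial_region f"
  proof (intro set_eqI iffI)
    fix x assume "x \<in> radial_region f"
    then have x: "x \<noteq> 0" "norm x < f (sgn x)" by (auto simp: radial_region_def)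
    from order_tendstoD(1)[OF lim x(2)] obtain i where "norm x < U i (sgn x)"
      by (auto simp: eventually_sequentially)
    then show "x \<in> (\<Union>i. radial_region (U i))" using x by (auto simp: radial_region_def)
  next
    fix x assume "x \<in> (\<Union>i. radial_region (U i))"
    then show "x \<in> radial_region f" using le[of _ "sgn x"] by (auto simp: radial_region_def intro: less_le_trans)
  qed
  moreover have "incseq (\<lambda>i. radial_region (U i))"
    using inc by (auto simp: incseq_def radial_region_def intro: less_le_trans)
  ultimately have "(\<lambda>i. emeasure lborel (radial_region (U i))) \<longlonglongrightarrow> emeasure lborel (radial_region f)"
    using Lim_emeasure_incseq[of "\<lambda>i. radial_region (U i)" lborel] by (auto simp: image_subset_iff)
  moreover have "(\<lambda>i. \<integral>\<^sup>+x\<in>ball 0 1 - {0}. ennreal (U i (sgn x) ^ DIM('a)) \<partial>lborel)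
      \<longlonglongrightarrow> (\<integral>\<^sup>+x\<in>ball 0 1 - {0}. ennreal (f (sgn x) ^ DIM('a)) \<partial>lborel)"
  proof (rule nn_integral_LIMSEQ)
    show "incseq (\<lambda>i x. ennreal (U i (sgn x) ^ DIM('a)) * indicator (ball 0 1 - {0}) x)"
      unfolding incseq_def le_fun_def
      by (intro allI impI mult_right_mono ennreal_leI power_mono inc seq.hyps(2)) auto
    show "(\<lambda>x. ennreal (U i (sgn x) ^ DIM('a)) * indicator (ball 0 1 - {0}) x) \<in> borel_measurable lborel" for i
      by (intro radial_weight_measurable seq.hyps)
    show "(\<lambda>i. ennreal (U i (sgn x) ^ DIM('a)) * indicator (ball 0 1 - {0}) x)
      \<longlonglongrightarrow> ennreal (f (sgn x) ^ DIM('a)) * indicator (ball 0 1 - {0}) x" for x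
      by (cases "x \<in> ball 0 1 - {0}") (auto intro!: tendsto_ennrealI tendsto_power lim)
  qed
  ultimately show ?case using seq.IH LIMSEQ_unique by simp
qed

text \<open>
  The polar coordinate formula measures the part of \<open>Q\<close> strictly below its radial function. The rest
  carries no volume, since \<open>Q\<close> lies in the region scaled by any \<open>c > 1\<close>, whose volume is larger by the factor \<open>c ^ n\<close> only.
\<close>

lemma volume_star_body:
  fixes Q :: "'a::euclidean_space set"
  assumes Q: "Q \<in> star_bodies_o"
  shows "(LINT u|spherical_lebesgue. radial_fun Q u ^ DIM('a)) = real DIM('a) * measure lebesgue Q"
    and "0 < measure lebesgue Q"
proof -
  note Q' = star_bodyD[OF Q]
  \<comment> \<open>The radial function is known to be continuous on the sphere only, hence the cut-off.\<close>
  define F where "F x = (if x \<in> sphere 0 1 then radial_fun Q x else 0)" for x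
  have rho: "radial_fun Q \<in> borel_measurable borel_sphere"
    using Q'(4) by (rule borel_measurable_continuous_on_restrict)
  then have F: "F \<in> borel_measurable borel"
    unfolding F_def by (subst measurable_restrict_space_iff[symmetric]) auto
  have rho_nonneg: "0 \<le> radial_fun Q u" if "norm u = 1" for u
    using radial_fun_mem(2) Q' that by blast
  have F_nonneg: "0 \<le> F x" for x using rho_nonneg by (simp add: F_def)
  have F_sgn: "F (sgn x) = radial_fun Q (sgn x)" if "x \<noteq> 0" for x
    using that by (simp add: F_def norm_sgn)
  have Qborel: "Q \<in> sets borel" using Q' by (simp add: borel_compact)
  let ?R = "radial_region F"
  have R: "?R \<in> sets borel" using F by (rule radial_region_borel)
  have "?R \<subseteq> Q"
  proof
    fix x assume "x \<in> ?R"
    then have "x \<noteq> 0" "norm x \<le> radial_fun Q (sgn x)" using F_sgn by (auto simp: radial_region_def)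
    then show "x \<in> Q" using mem_if_norm_le_radial_fun Q' by blast
  qed
  have Q_fin: "emeasure lborel Q < \<infinity>"
    using Q'(1) by (intro emeasure_bounded_finite compact_imp_bounded)
  have R_fin: "emeasure lborel ?R < \<infinity>"
    using emeasure_mono[OF \<open>?R \<subseteq> Q\<close>, of lborel] Qborel Q_fin by (auto intro: le_less_trans)
  have upper: "emeasure lborel Q \<le> ennreal (c ^ DIM('a)) * emeasure lborel ?R" if "1 < c" for c :: real
  proof -
    let ?cR = "radial_region (\<lambda>x. c * F x)"
    have cR: "?cR \<in> sets borel" by (intro radial_region_borel borel_measurable_times F) auto
    have "Q \<subseteq> {0} \<union> ?cR"
    proof
      fix x assume "x \<in> Q"
      show "x \<in> {0} \<union> ?cR"
      proof (cases "x = 0")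
        case False
        then have "norm x \<le> F (sgn x)" using norm_le_radial_fun[OF Q'(1) \<open>x \<in> Q\<close>] F_sgn by simp
        moreover have "0 < F (sgn x)" using calculation False zero_less_norm_iff[of x] by linarith
        then have "F (sgn x) < c * F (sgn x)"
          using mult_strict_right_mono[OF \<open>1 < c\<close>, of "F (sgn x)"] by simp
        ultimately show ?thesis using False by (auto simp: radial_region_def)
      qed simp
    qed
    then have "emeasure lborel Q \<le> emeasure lborel ({0} \<union> ?cR)"
      using cR by (intro emeasure_mono) auto
    also have "\<dots> \<le> emeasure lborel {0::'a} + emeasure lborel ?cR"
      using cR by (intro emeasure_subadditive) auto
    also have "\<dots> = ennreal (c ^ DIM('a)) * emeasure lborel ?R"
      using emeasure_radial_region_scale[OF F, of c] \<open>1 < c\<close> by simp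
    finally show ?thesis .
  qed
  \<comment> \<open>Let c decrease to 1.\<close>
  have "measure lborel Q \<le> measure lborel ?R"
  proof (rule LIMSEQ_le_const)
    have "(\<lambda>k. (1 + 1 / real (Suc k)) ^ DIM('a) * measure lborel ?R)
        \<longlonglongrightarrow> (1 + 0) ^ DIM('a) * measure lborel ?R"
      by (intro tendsto_intros LIMSEQ_Suc[OF lim_1_over_n])
    then show "(\<lambda>k. (1 + 1 / real (Suc k)) ^ DIM('a) * measure lborel ?R) \<longlonglongrightarrow> measure lborel ?R"
      by simp
    have "measure lborel Q \<le> (1 + 1 / real (Suc k)) ^ DIM('a) * measure lborel ?R" for k
    proof -
      have "ennreal (measure lborel Q)
          \<le> ennreal ((1 + 1 / real (Suc k)) ^ DIM('a)) * ennreal (measure lborel ?R)"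
        using upper[of "1 + 1 / real (Suc k)"] Q_fin R_fin
        by (simp add: emeasure_eq_ennreal_measure less_top)
      also have "\<dots> = ennreal ((1 + 1 / real (Suc k)) ^ DIM('a) * measure lborel ?R)"
        by (subst ennreal_mult) auto
      finally show ?thesis by (subst (asm) ennreal_le_iff) auto
    qed
    then show "\<exists>N. \<forall>k\<ge>N. measure lborel Q \<le> (1 + 1 / real (Suc k)) ^ DIM('a) * measure lborel ?R"
      by blast
  qed
  moreover have "emeasure lborel ?R \<le> emeasure lborel Q"
    using \<open>?R \<subseteq> Q\<close> Qborel by (intro emeasure_mono) auto
  then have "measure lborel ?R \<le> measure lborel Q"
    unfolding measure_def using Q_fin by (intro enn2real_mono) auto
  ultimately have eq: "measure lebesgue Q = measure lborel ?R"
    using Qborel by simp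
  have "(\<integral>\<^sup>+u. ennreal (radial_fun Q u ^ DIM('a)) \<partial>spherical_lebesgue)
      = of_nat DIM('a) * (\<integral>\<^sup>+x\<in>ball 0 1 - {0}. ennreal (radial_fun Q (sgn x) ^ DIM('a)) \<partial>lborel)"
    using rho by (intro nn_integral_spherical) auto
  also have "(\<integral>\<^sup>+x\<in>ball 0 1 - {0}. ennreal (radial_fun Q (sgn x) ^ DIM('a)) \<partial>lborel)
      = (\<integral>\<^sup>+x\<in>ball 0 1 - {0}. ennreal (F (sgn x) ^ DIM('a)) \<partial>lborel)"
    by (intro nn_integral_cong) (auto simp: F_sgn split: split_indicator)
  also have "\<dots> = emeasure lborel ?R"
    using emeasure_radial_region[OF F F_nonneg] by simp
  also have "\<dots> = ennreal (measure lebesgue Q)"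
    using R_fin eq by (simp add: emeasure_eq_ennreal_measure less_top)
  also have "of_nat DIM('a) * \<dots> = ennreal (real DIM('a) * measure lebesgue Q)"
    by (simp add: ennreal_mult ennreal_of_nat_eq_real_of_nat)
  finally have nn: "(\<integral>\<^sup>+u. ennreal (radial_fun Q u ^ DIM('a)) \<partial>spherical_lebesgue)
      = ennreal (real DIM('a) * measure lebesgue Q)" .
  show "(LINT u|spherical_lebesgue. radial_fun Q u ^ DIM('a)) = real DIM('a) * measure lebesgue Q"
    using rho_nonneg
    by (subst integral_eq_nn_integral)
       (auto simp: nn intro!: measurable_spherical borel_measurable_power rho)
  obtain r where r: "0 < r" "ball 0 r \<subseteq> Q" using Q'(2) by (auto simp: mem_interior)
  have "0 < measure lborel (ball (0::'a) r)" using r by (simp add: content_ball_pos)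
  also have "\<dots> \<le> measure lborel Q"
    using r Q_fin Qborel by (intro measure_mono_fmeasurable) (auto simp: fmeasurable_def)
  finally show "0 < measure lebesgue Q" using Qborel by simp
qed

section \<open>The mixed volume as an integral over directions\<close>

text \<open>
  Pulling the mixed volume back along the radial Gauss map turns it into an integral in \<open>u\<close>, where
  it can be compared with the integrals of radial functions.
\<close>

lemma Lp_dual_mixed_volume_eq_integral:
  fixes K L Q :: "'a::euclidean_space set"
  assumes K: "K \<in> convex_bodies_o" and L: "L \<in> convex_bodies_o" and Q: "Q \<in> star_bodies_o"
  shows "Lp_dual_mixed_volume p q K L Q =
    (LINT u|spherical_lebesgue. 1 / real DIM('a) *
        (radial_fun K u powr q * radial_fun Q u powr (real DIM('a) - q)) *
        (support_fun L (radial_gauss_map K u) / support_fun K (radial_gauss_map K u)) powr p)"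
proof -
  let ?S = "spherical_lebesgue :: 'a measure"
  let ?w = "\<lambda>u. 1 / real DIM('a) * (radial_fun K u powr q * radial_fun Q u powr (real DIM('a) - q))"
  note K' = convex_bodyD[OF K] and L' = convex_bodyD[OF L]
  have gauss [measurable]: "radial_gauss_map K \<in> ?S \<rightarrow>\<^sub>M borel_sphere"
    by (intro measurable_spherical radial_gauss_map_measurable K)
  have [measurable]: "radial_fun K \<in> borel_measurable ?S" "radial_fun Q \<in> borel_measurable ?S"
    using continuous_on_radial_fun[OF K] star_bodyD(4)[OF Q]
    by (auto intro: continuous_measurable_spherical)
  have [measurable]: "support_fun K \<in> borel_measurable borel_sphere"
    "support_fun L \<in> borel_measurable borel_sphere"
    using K' L' by (auto intro!: borel_measurable_continuous_on_restrict continuous_on_support_fun)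
  let ?D = "distr (density ?S (\<lambda>u. ennreal (?w u))) borel_sphere (radial_gauss_map K)"
  have D: "dual_curvature_measure q K Q = ?D"
    unfolding dual_curvature_measure_eq_distr[OF K Q] by (subst ennreal_mult[symmetric]) auto
  have "Lp_dual_mixed_volume p q K L Q
      = (LINT v|?D. support_fun K v powr (- p) * support_fun L v powr p)"
    unfolding Lp_dual_mixed_volume_def Lp_dual_curvature_measure_def D
    by (subst integral_density) auto
  also have "\<dots> = (LINT u|density ?S (\<lambda>u. ennreal (?w u)).
      support_fun K (radial_gauss_map K u) powr (- p) * support_fun L (radial_gauss_map K u) powr p)"
    by (subst integral_distr) auto
  also have "\<dots> = (LINT u|?S. ?w u *
      (support_fun K (radial_gauss_map K u) powr (- p) * support_fun L (radial_gauss_map K u) powr p))"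
    by (subst integral_density) auto
  also have "\<dots> = (LINT u|?S. ?w u *
      (support_fun L (radial_gauss_map K u) / support_fun K (radial_gauss_map K u)) powr p)"
  proof (intro Bochner_Integration.integral_cong refl)
    fix u assume "u \<in> space ?S"
    then have "norm (radial_gauss_map K u) = 1" using norm_radial_gauss_map[OF K] by simp
    then have "0 < support_fun K (radial_gauss_map K u)" "0 < support_fun L (radial_gauss_map K u)"
      using support_fun_pos K' L' by blast+
    then show "?w u * (support_fun K (radial_gauss_map K u) powr (- p) * support_fun L (radial_gauss_map K u) powr p)
      = ?w u * (support_fun L (radial_gauss_map K u) / support_fun K (radial_gauss_map K u)) powr p"
      by (simp add: powr_divide powr_minus field_simps)
  qed
  finally show ?thesis .
qed

section \<open>The equality case of the exponential Jensen inequality\<close>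

lemma exp_ge_tangent: "exp a * (1 + (x - a)) \<le> exp (x::real)"
proof -
  have "exp a * (1 + (x - a)) \<le> exp a * exp (x - a)"
    by (intro mult_left_mono exp_ge_add_one_self) simp
  then show ?thesis by (simp flip: exp_add)
qed

lemma exp_eq_tangent_iff: "exp (x::real) = exp a * (1 + (x - a)) \<longleftrightarrow> x = a"
proof
  assume "exp x = exp a * (1 + (x - a))"
  moreover have "exp x = exp a * exp (x - a)" by (simp flip: exp_add)
  ultimately have "exp (x - a) = 1 + (x - a)" by simp
  then have "ln (exp (x - a)) = exp (x - a) - 1" unfolding ln_exp by linarith
  then have "exp (x - a) = 1" by (intro ln_eq_minus_one) auto
  then show "x = a" by simp
qed simp

text \<open>
  Jensen's inequality for the exponential function, with its equality case. Integrating the tangent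
  inequality for the exponential at the mean \<open>p * m\<close> gives the estimate; if equality holds, the
  nonnegative defect has integral zero, and so vanishes almost everywhere, which forces \<open>f = m\<close>
  because the tangent touches only there.
\<close>

lemma weighted_mean_le_ln_exp_mean:
  fixes f w :: "'b \<Rightarrow> real"
  assumes w: "integrable M w" and fw: "integrable M (\<lambda>u. f u * w u)"
    and ew: "integrable M (\<lambda>u. exp (p * f u) * w u)"
    and wpos: "\<forall>u\<in>space M. 0 < w u" and p: "0 < p"
    and W: "W = (LINT u|M. w u)" "0 < W"
  defines "m \<equiv> (LINT u|M. f u * w u) / W"
    and "I \<equiv> LINT u|M. exp (p * f u) * w u"
  shows "0 < I" and "m \<le> 1 / p * ln (I / W)"
    and "m = 1 / p * ln (I / W) \<Longrightarrow> AE u in M. f u = m"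
proof -
  \<comment> \<open>The weighted tangent at the mean; its linear part integrates to zero.\<close>
  let ?T = "\<lambda>u. exp (p * m) * (1 + (p * f u - p * m)) * w u"
  have T: "?T = (\<lambda>u. exp (p * m) * (1 - p * m) * w u + exp (p * m) * p * (f u * w u))"
    by (auto simp: algebra_simps)
  have T_int: "integrable M ?T" unfolding T using w fw by auto
  have "(LINT u|M. ?T u) = exp (p * m) * (1 - p * m) * W + exp (p * m) * p * (m * W)"
    unfolding T using w fw W by (simp add: m_def)
  also have "\<dots> = exp (p * m) * W" by (simp add: algebra_simps)
  finally have T_val: "(LINT u|M. ?T u) = exp (p * m) * W" .
  have le: "?T u \<le> exp (p * f u) * w u" if "u \<in> space M" for u
    using bspec[OF wpos that] exp_ge_tangent by (intro mult_right_mono) auto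
  have I_ge: "exp (p * m) * W \<le> I"
    unfolding T_val[symmetric] I_def by (intro integral_mono T_int ew le)
  then show "0 < I" using W(2) by (meson exp_gt_zero less_le_trans mult_pos_pos)
  have IW: "exp (p * m) \<le> I / W" using I_ge W(2) by (simp add: field_simps)
  then have "p * m \<le> ln (I / W)" using \<open>0 < I\<close> W(2) by (subst ln_ge_iff) auto
  then show "m \<le> 1 / p * ln (I / W)" using p by (simp add: field_simps)
  show "AE u in M. f u = m" if eq: "m = 1 / p * ln (I / W)"
  proof -
    have "p * m = ln (I / W)" using eq p by simp
    then have "exp (p * m) = I / W" using \<open>0 < I\<close> W(2) by simp
    then have "I = exp (p * m) * W" using W(2) by simp
    then have "(LINT u|M. exp (p * f u) * w u - ?T u) = 0"
      using T_val Bochner_Integration.integral_diff[OF ew T_int] by (simp add: I_def)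
    moreover have "integrable M (\<lambda>u. exp (p * f u) * w u - ?T u)"
      using ew T_int by (rule Bochner_Integration.integrable_diff)
    ultimately have "AE u in M. exp (p * f u) * w u - ?T u = 0"
      using le by (subst integral_nonneg_eq_0_iff_AE[symmetric]) auto
    then show ?thesis
      using AE_space
    proof eventually_elim
      case (elim u)
      then have "exp (p * f u) = exp (p * m) * (1 + (p * f u - p * m))"
        using wpos by fastforce
      then show "f u = m" using exp_eq_tangent_iff[of "p * f u" "p * m"] p by simp
    qed
  qed
qed

section \<open>The inequality and its equality case\<close>

lemma integrable_continuous_spherical:
  fixes f :: "'a::euclidean_space \<Rightarrow> real"
  assumes "continuous_on (sphere 0 1) f"
  shows "integrable spherical_lebesgue f"
proof -
  have "bounded (f ` sphere 0 1)"
    using assms by (intro compact_imp_bounded compact_continuous_image) auto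
  then obtain B where "\<forall>u\<in>sphere 0 1. norm (f u) \<le> B"
    by (auto simp: bounded_iff)
  then show ?thesis
    using assms
    by (intro finite_measure.integrable_const_bound[OF finite_measure_spherical, of _ B]
        continuous_measurable_spherical) auto
qed

lemma Lp_dual_mixed_volume_zero_eq:
  fixes K L Q :: "'a::euclidean_space set"
  assumes K: "K \<in> convex_bodies_o" and L: "L \<in> convex_bodies_o" and Q: "Q \<in> star_bodies_o"
  shows "Lp_dual_mixed_volume p 0 K L Q =
    1 / real DIM('a) * (LINT u|spherical_lebesgue.
        (support_fun L (radial_gauss_map K u) / support_fun K (radial_gauss_map K u)) powr p
        * radial_fun Q u ^ DIM('a))"
proof -
  note K' = convex_bodyD[OF K] and Q' = star_bodyD[OF Q]
  have "1 / real DIM('a) * (radial_fun K u powr 0 * radial_fun Q u powr (real DIM('a) - 0)) * x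
      = 1 / real DIM('a) * (x * radial_fun Q u ^ DIM('a))" if "norm u = 1" for u x
    using radial_fun_pos[OF K'(1,3) that] radial_fun_pos[OF Q'(1,2) that]
    by (simp add: powr_realpow)
  then have "Lp_dual_mixed_volume p 0 K L Q = (LINT u|spherical_lebesgue. 1 / real DIM('a) *
      ((support_fun L (radial_gauss_map K u) / support_fun K (radial_gauss_map K u)) powr p
        * radial_fun Q u ^ DIM('a)))"
    unfolding Lp_dual_mixed_volume_eq_integral[OF K L Q]
    by (intro Bochner_Integration.integral_cong) auto
  then show ?thesis by simp
qed

text \<open>
  The radial Gauss map takes its values in the compact sphere, where the quotient of the support
  functions is continuous and hence bounded.
\<close>

lemma integrable_support_quotient:
  fixes K L :: "'a::euclidean_space set"
  assumes K: "K \<in> convex_bodies_o" and L: "L \<in> convex_bodies_o"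
    and w: "continuous_on (sphere 0 1) w"
  shows "integrable spherical_lebesgue (\<lambda>u.
      (support_fun L (radial_gauss_map K u) / support_fun K (radial_gauss_map K u)) powr p * w u)"
proof -
  let ?S = "spherical_lebesgue :: 'a measure"
  let ?H = "\<lambda>v. (support_fun L v / support_fun K v) powr p"
  note K' = convex_bodyD[OF K] and L' = convex_bodyD[OF L]
  have H: "continuous_on (sphere 0 1) ?H"
  proof (intro continuous_intros continuous_on_support_fun)
    show "\<forall>v\<in>sphere 0 1. support_fun K v \<noteq> 0"
      "\<forall>v\<in>sphere 0 1. support_fun L v / support_fun K v \<noteq> 0"
      using support_fun_pos[OF K'(1,3)] support_fun_pos[OF L'(1,3)] by force+
  qed (use K' L' in auto)
  have "bounded (?H ` sphere 0 1)" "bounded (w ` sphere 0 1)"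
    using H w by (intro compact_imp_bounded compact_continuous_image; simp)+
  then obtain A B where A: "\<forall>v\<in>sphere 0 1. norm (?H v) \<le> A"
    and B: "\<forall>v\<in>sphere 0 1. norm (w v) \<le> B"
    unfolding bounded_iff by auto
  have gauss: "radial_gauss_map K \<in> ?S \<rightarrow>\<^sub>M borel_sphere"
    by (intro measurable_spherical radial_gauss_map_measurable K)
  show ?thesis
  proof (rule finite_measure.integrable_const_bound[OF finite_measure_spherical])
    show "(\<lambda>u. ?H (radial_gauss_map K u) * w u) \<in> borel_measurable ?S"
      by (intro borel_measurable_times continuous_measurable_spherical w
          measurable_compose[OF gauss borel_measurable_continuous_on_restrict[OF H]])
    have "norm (?H (radial_gauss_map K u) * w u) \<le> A * B" if u: "norm u = 1" for u
    proof -
      have HA: "norm (?H (radial_gauss_map K u)) \<le> A" and "norm (w u) \<le> B"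
        using A B u norm_radial_gauss_map[OF K u] by auto
      moreover have "0 \<le> A" using HA by (rule order_trans[OF norm_ge_zero])
      ultimately show ?thesis unfolding norm_mult by (intro mult_mono) auto
    qed
    then show "AE u in ?S. norm (?H (radial_gauss_map K u) * w u) \<le> A * B"
      by (intro AE_I2) simp
  qed
qed

theorem theorem3p5:
  fixes K L Q :: "'a::euclidean_space set" and p :: real
  assumes "Q \<in> star_bodies_o" and "p > 0"
    and "K \<in> convex_bodies_o" and "L \<in> convex_bodies_o"
  shows "1 / (real DIM('a) * measure lebesgue Q) *
           (LINT u|spherical_lebesgue. ln (radial_fun L u / radial_fun K u) * radial_fun Q u ^ DIM('a))
         \<le> 1 / p * ln (Lp_dual_mixed_volume p 0 K L Q / measure lebesgue Q)
       \<and> (1 / (real DIM('a) * measure lebesgue Q) *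
           (LINT u|spherical_lebesgue. ln (radial_fun L u / radial_fun K u) * radial_fun Q u ^ DIM('a))
         = 1 / p * ln (Lp_dual_mixed_volume p 0 K L Q / measure lebesgue Q)
         \<longleftrightarrow> dilates K L)"
proof -
  let ?S = "spherical_lebesgue :: 'a measure" and ?n = "real DIM('a)"
  let ?V = "measure lebesgue Q" and ?M = "Lp_dual_mixed_volume p 0 K L Q"
  note Q = assms(1) and p = assms(2) and K = assms(3) and L = assms(4)
  note K' = convex_bodyD[OF K] and L' = convex_bodyD[OF L] and Q' = star_bodyD[OF Q]
  define w where "w u = radial_fun Q u ^ DIM('a)" for u
  define f where "f u = ln (radial_fun L u / radial_fun K u)" for u
  define H where
    "H u = support_fun L (radial_gauss_map K u) / support_fun K (radial_gauss_map K u)" for u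
  define W where "W = (LINT u|?S. w u)"
  define m where "m = (LINT u|?S. f u * w u) / W"
  define I where "I = (LINT u|?S. exp (p * f u) * w u)"
  define J where "J = (LINT u|?S. H u powr p * w u)"
  have W: "W = ?n * ?V" "0 < W" and V: "0 < ?V"
    using volume_star_body[OF Q] by (simp_all add: W_def w_def)
  have M: "?M / ?V = J / W"
    using Lp_dual_mixed_volume_zero_eq[OF K L Q, of p] W V by (simp add: J_def H_def w_def)
  have rho_pos: "0 < radial_fun K u" "0 < radial_fun L u" "0 < radial_fun Q u" if "norm u = 1" for u
    using radial_fun_pos K' L' Q' that by blast+
  have exp_f: "exp (p * f u) = (radial_fun L u / radial_fun K u) powr p" if "norm u = 1" for u
    using rho_pos[OF that] by (simp add: f_def powr_def)
  have w_cont: "continuous_on (sphere 0 1) w"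
    unfolding w_def by (intro continuous_intros Q')
  have f_cont: "continuous_on (sphere 0 1) f"
    unfolding f_def using rho_pos
    by (intro continuous_intros continuous_on_radial_fun K L) (auto simp: less_le)
  have w_int: "integrable ?S w" and fw_int: "integrable ?S (\<lambda>u. f u * w u)"
    and ew_int: "integrable ?S (\<lambda>u. exp (p * f u) * w u)"
    by (intro integrable_continuous_spherical continuous_intros w_cont f_cont)+
  have w_pos: "\<forall>u\<in>space ?S. 0 < w u" using rho_pos by (simp add: w_def)
  note jensen = weighted_mean_le_ln_exp_mean[OF w_int fw_int ew_int w_pos p W_def W(2),
      folded m_def I_def]
  have "I \<le> J"
    unfolding I_def J_def
  proof (rule integral_mono_AE)
    show "integrable ?S (\<lambda>u. H u powr p * w u)"
      unfolding H_def by (intro integrable_support_quotient K L w_cont)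
    show "AE u in ?S. exp (p * f u) * w u \<le> H u powr p * w u"
      using AE_regular_direction[OF K] AE_space
    proof eventually_elim
      case (elim u)
      then have u: "norm u = 1" by simp
      have "radial_fun L u / radial_fun K u \<le> H u"
        unfolding H_def
        by (intro radial_quotient_le_support_quotient K L u radial_gauss_map_outer_normal elim)
      then have "exp (p * f u) \<le> H u powr p"
        unfolding exp_f[OF u] using rho_pos[OF u] p by (intro powr_mono2) auto
      then show ?case using bspec[OF w_pos, of u] elim by (intro mult_right_mono) auto
    qed
  qed (rule ew_int)
  then have IJ: "1 / p * ln (I / W) \<le> 1 / p * ln (J / W)"
    using jensen(1) W(2) p by (intro mult_left_mono) (auto simp: divide_right_mono)
  have "m \<le> 1 / p * ln (J / W)" using jensen(2) IJ by (rule order_trans)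
  moreover have "m = 1 / p * ln (J / W) \<longleftrightarrow> dilates K L"
  proof
    assume "m = 1 / p * ln (J / W)"
    \<comment> \<open>Equality between the outer terms forces equality in Jensen, so the logarithmic quotient is constant.\<close>
    then have "m = 1 / p * ln (I / W)" using jensen(2) IJ by linarith
    then have ae: "AE u in ?S. f u = m" by (rule jensen(3))
    have "radial_fun L u = exp m * radial_fun K u" if "norm u = 1" for u
    proof -
      have "ln (radial_fun L u / radial_fun K u) = m"
        using continuous_eq_const_if_AE_spherical[OF f_cont ae that] by (simp add: f_def)
      then have "exp m = radial_fun L u / radial_fun K u" using rho_pos[OF that] by auto
      then show ?thesis using rho_pos[OF that] by simp
    qed
    then show "dilates K L" by (intro dilates_if_radial_fun_proportional[OF K L]) auto
  next
    assume "dilates K L"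
    then obtain c where c: "0 < c" "K = (*\<^sub>R) c ` L" by (auto simp: dilates_def)
    have f: "f u = ln (1 / c)" if "norm u = 1" for u
      using radial_fun_dilate[OF L'(1,4) c(1) that] rho_pos[OF that] c by (simp add: f_def)
    have H: "H u = 1 / c" if u: "norm u = 1" for u
    proof -
      let ?v = "radial_gauss_map K u"
      have "support_fun K ?v = c * support_fun L ?v"
        unfolding c(2) using L' c(1) by (intro support_fun_dilate) auto
      moreover have "0 < support_fun L ?v"
        using support_fun_pos[OF L'(1,3)] norm_radial_gauss_map[OF K u] by blast
      ultimately show ?thesis using c(1) by (simp add: H_def)
    qed
    have "(LINT u|?S. f u * w u) = (LINT u|?S. ln (1 / c) * w u)"
      using f by (intro Bochner_Integration.integral_cong) auto
    then have "m = ln (1 / c)" using W(2) by (simp add: m_def W_def)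
    moreover have "J = (LINT u|?S. (1 / c) powr p * w u)"
      unfolding J_def using H by (intro Bochner_Integration.integral_cong) auto
    then have "J / W = (1 / c) powr p" using W(2) by (simp add: W_def)
    ultimately show "m = 1 / p * ln (J / W)" using c(1) p by (simp add: ln_powr)
  qed
  moreover have "1 / (?n * ?V) *
      (LINT u|?S. ln (radial_fun L u / radial_fun K u) * radial_fun Q u ^ DIM('a)) = m"
    by (simp add: m_def W(1) f_def w_def)
  ultimately show ?thesis unfolding M by simp
qed

end
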